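(* Let the setting and the two boundary value problems (NL) and (L) be as described in the context, and assume that there are positive real constants $C_1,\dots,C_N$ such that $$\lambda(T)=C_k\,\lambda_k(T)\qquad\text{for all } T\in\mathbb{R},\ k=1,\dots,N.$$ Then the nonlinear problem (NL) and the linear problem (L) are equivalent, in the following sense. A pair $(T,(T_k)_{k=1}^N)$ solves (NL), for given data $A,\theta$ and cell-boundary flux functions $q_j^\pm$, if and only if the functions $$u:=f(T)\ \text{in } D_{matrix},\qquad \tilde u_k:=C_k f_k(T_k)\ \text{in the copies of } D_k,$$ solve (L) with the same data $A,\theta,q_j^\pm$. Here $f(T)=\int_0^T\lambda(\xi)\,d\xi$ and $f_k(T)=\int_0^T\lambda_k(\xi)\,d\xi$. Conversely, the solution of (NL) is recovered from a solution of (L) by $$T=f^{-1}(u),\qquad T_k=f_k^{-1}\big(\tilde u_k/C_k\big).$$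
   Context: **Geometry.** Identify $\mathbb{R}^2$ with $\mathbb{C}$ via $z=x+\imath y$. Let $$Q_{(0,0)}=\{t_1+\imath t_2:\ -\tfrac12<t_1,t_2<\tfrac12\},\qquad Q_{(m_1,m_2)}=Q_{(0,0)}+m_1+\imath m_2\quad (m_1,m_2\in\mathbb{Z}).$$ Let $D_k=\{z:|z-a_k|<r_k\}$, $k=1,\dots,N$, be mutually disjoint disks whose closures lie inside $Q_{(0,0)}$, and set $D_0=Q_{(0,0)}\setminus\bigcup_{k}\overline{D_k}$. Define the matrix and the inclusions by $$D_{matrix}=\bigcup_{m_1,m_2}\big((D_0\cup\partial Q_{(0,0)})+m_1+\imath m_2\big),\qquad D_{inc}=\bigcup_{m_1,m_2}\bigcup_{k}\big(D_k+m_1+\imath m_2\big).$$ **Conductivities.** $\lambda,\lambda_1,\dots,\lambda_N\in C^\infty(\mathbb{R})$ are positive and finite-valued. **Data.** $A$ is a given flux intensity and $\theta$ a given direction angle. For each cell $Q_{(m_1,m_2)}$ there are functions $q_1^\pm(\cdot,m_1,m_2)$ and $q_2^\pm(\cdot,m_1,m_2)$ describing flux fluctuations on the top/bottom and right/left sides of the cell, in the local coordinate $-\tfrac12<x<\tfrac12$ (resp. $-\tfrac12<y<\tfrac12$). **Problem (NL).** Find $T$ in $D_{matrix}$ and $T_k$ in the copies of $D_k$ such that: - $\nabla\cdot(\lambda(T)\nabla T)=0$ in $D_{matrix}$; - $\nabla\cdot(\lambda_k(T_k)\nabla T_k)=0$ in $\bigcup_{m_1,m_2}(D_k+m_1+\imath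 m_2)$; - on the top (resp. bottom) side of each cell $Q_{(m_1,m_2)}$, $\lambda(T)T_y=-A\sin\theta+q_1^+(x+m_1,m_1,m_2)$ (resp. with $q_1^-$); - on the right (resp. left) side, $\lambda(T)T_x=-A\cos\theta+q_2^+(y+m_2,m_1,m_2)$ (resp. with $q_2^-$); - on every $\partial D_k+m_1+\imath m_2$, $T=T_k$ and $\lambda(T)\,\partial T/\partial n=\lambda_k(T_k)\,\partial T_k/\partial n$. Here $n$ is the outward unit normal to $\partial D_k$, and $T,T_k$ on the interface denote the limits from the matrix side and the inclusion side respectively. **Problem (L).** Find $u$ in $D_{matrix}$ and $\tilde u_k$ in the copies of $D_k$ such that: - $\Delta u=0$ in $D_{matrix}$; - $\Delta\tilde u_k=0$ in the copies of $D_k$; - $u_y=-A\sin\theta+q_1^\pm(x+m_1,m_1,m_2)$ on the top/bottom sides of each cell; - $u_x=-A\cos\theta+q_2^\pm(y+m_2,m_1,m_2)$ on the right/left sides of each cell; - on every $\partial D_k+m_1+\imath m_2$, $u=\tilde u_k$ and $\partial u/\partial n=\frac{1}{C_k}\,\partial\tilde u_k/\partial n$. The functions $f$ and $f_k$ are continuous and strictly increasing, hence invertible.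
   Formalization: The recovery of (NL) from a solution of (L) is stated for u with values in the range of f and ũ_k/C_k in the range of f_k; f may be bounded (e.g. λ(T)=1/(1+T²)), and otherwise f^{-1}(u) is undefined. *)

theory Defs
  imports "HOL-Analysis.Analysis"
begin

text \<open>The plane R^2 is identified with the complex numbers; all fields are functions complex => real.\<close>

definition smooth_real :: "(real \<Rightarrow> real) \<Rightarrow> bool" where
  "smooth_real g \<longleftrightarrow> (\<forall>n x. ((deriv ^^ n) g) field_differentiable (at x))"

definition kirchhoff :: "(real \<Rightarrow> real) \<Rightarrow> real \<Rightarrow> real" where
  "kirchhoff g T = (if 0 \<le> T then integral {0..T} g else - integral {T..0} g)"

definition px :: "(complex \<Rightarrow> real) \<Rightarrow> complex \<Rightarrow> real" where
  "px T z = deriv (\<lambda>t::real. T (z + of_real t)) 0"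

definition py :: "(complex \<Rightarrow> real) \<Rightarrow> complex \<Rightarrow> real" where
  "py T z = deriv (\<lambda>t::real. T (z + \<i> * of_real t)) 0"

definition dn :: "complex \<Rightarrow> (complex \<Rightarrow> real) \<Rightarrow> complex \<Rightarrow> real" where
  "dn v T z = px T z * Re v + py T z * Im v"

definition Q0 :: "complex set" where
  "Q0 = {z. -1/2 < Re z \<and> Re z < 1/2 \<and> -1/2 < Im z \<and> Im z < 1/2}"

definition shift :: "int \<Rightarrow> int \<Rightarrow> complex" where
  "shift m1 m2 = of_int m1 + \<i> * of_int m2"

definition D0 :: "nat \<Rightarrow> (nat \<Rightarrow> complex) \<Rightarrow> (nat \<Rightarrow> real) \<Rightarrow> complex set" where
  "D0 N a r = Q0 - (\<Union>k\<in>{1..N}. cball (a k) (r k))"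

definition Dmatrix :: "nat \<Rightarrow> (nat \<Rightarrow> complex) \<Rightarrow> (nat \<Rightarrow> real) \<Rightarrow> complex set" where
  "Dmatrix N a r = (\<Union>m1. \<Union>m2. (\<lambda>z. z + shift m1 m2) ` (D0 N a r \<union> frontier Q0))"

definition Dinc :: "(nat \<Rightarrow> complex) \<Rightarrow> (nat \<Rightarrow> real) \<Rightarrow> nat \<Rightarrow> complex set" where
  "Dinc a r k = (\<Union>m1. \<Union>m2. ball (a k + shift m1 m2) (r k))"

definition div_eq :: "(real \<Rightarrow> real) \<Rightarrow> (complex \<Rightarrow> real) \<Rightarrow> complex \<Rightarrow> bool" where
  "div_eq c T z \<longleftrightarrow> T differentiable (at z)
     \<and> (\<lambda>w. c (T w) * px T w) differentiable (at z)
     \<and> (\<lambda>w. c (T w) * py T w) differentiable (at z)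
     \<and> px (\<lambda>w. c (T w) * px T w) z + py (\<lambda>w. c (T w) * py T w) z = 0"

definition laplace_eq :: "(complex \<Rightarrow> real) \<Rightarrow> complex \<Rightarrow> bool" where
  "laplace_eq u z \<longleftrightarrow> u differentiable (at z)
     \<and> px u differentiable (at z) \<and> py u differentiable (at z)
     \<and> px (px u) z + py (py u) z = 0"

text \<open>Boundary conditions on the cell sides: for the flux G = (G_x, G_y).
  Points of the top side of cell (m1,m2) are (x+m1) + i(m2+1/2) with local coordinate -1/2<x<1/2.\<close>
definition cell_bc ::
  "(complex \<Rightarrow> real) \<Rightarrow> (complex \<Rightarrow> real) \<Rightarrow> real \<Rightarrow> real
   \<Rightarrow> (real \<Rightarrow> int \<Rightarrow> int \<Rightarrow> real) \<Rightarrow> (real \<Rightarrow> int \<Rightarrow> int \<Rightarrow> real)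
   \<Rightarrow> (real \<Rightarrow> int \<Rightarrow> int \<Rightarrow> real) \<Rightarrow> (real \<Rightarrow> int \<Rightarrow> int \<Rightarrow> real) \<Rightarrow> bool" where
  "cell_bc Gx Gy A \<theta> q1p q1m q2p q2m \<longleftrightarrow>
    (\<forall>m1 m2 (x::real). -1/2 < x \<and> x < 1/2 \<longrightarrow>
       Gy (of_real (x + of_int m1) + \<i> * of_real (of_int m2 + 1/2)) = - A * sin \<theta> + q1p (x + of_int m1) m1 m2
     \<and> Gy (of_real (x + of_int m1) + \<i> * of_real (of_int m2 - 1/2)) = - A * sin \<theta> + q1m (x + of_int m1) m1 m2
     \<and> Gx (of_real (of_int m1 + 1/2) + \<i> * of_real (x + of_int m2)) = - A * cos \<theta> + q2p (x + of_int m2) m1 m2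
     \<and> Gx (of_real (of_int m1 - 1/2) + \<i> * of_real (x + of_int m2)) = - A * cos \<theta> + q2m (x + of_int m2) m1 m2)"

text \<open>Problem (NL). Interface values are one-sided limits (matrix side / inclusion side); the
  outward normal of the disk centred c with radius r at p is (p-c)/r.\<close>
definition solves_NL ::
  "nat \<Rightarrow> (nat \<Rightarrow> complex) \<Rightarrow> (nat \<Rightarrow> real) \<Rightarrow> (real \<Rightarrow> real) \<Rightarrow> (nat \<Rightarrow> real \<Rightarrow> real)
   \<Rightarrow> real \<Rightarrow> real \<Rightarrow> (real \<Rightarrow> int \<Rightarrow> int \<Rightarrow> real) \<Rightarrow> (real \<Rightarrow> int \<Rightarrow> int \<Rightarrow> real)
   \<Rightarrow> (real \<Rightarrow> int \<Rightarrow> int \<Rightarrow> real) \<Rightarrow> (real \<Rightarrow> int \<Rightarrow> int \<Rightarrow> real)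
   \<Rightarrow> (complex \<Rightarrow> real) \<Rightarrow> (nat \<Rightarrow> complex \<Rightarrow> real) \<Rightarrow> bool" where
  "solves_NL N a r lam lamk A \<theta> q1p q1m q2p q2m T Tk \<longleftrightarrow>
     (\<forall>z\<in>Dmatrix N a r. div_eq lam T z)
   \<and> (\<forall>k\<in>{1..N}. \<forall>z\<in>Dinc a r k. div_eq (lamk k) (Tk k) z)
   \<and> cell_bc (\<lambda>z. lam (T z) * px T z) (\<lambda>z. lam (T z) * py T z) A \<theta> q1p q1m q2p q2m
   \<and> (\<forall>k\<in>{1..N}. \<forall>m1 m2 p. let c = a k + shift m1 m2 in cmod (p - c) = r k \<longrightarrow>
        (\<exists>l. (T \<longlongrightarrow> l) (at p within Dmatrix N a r) \<and> (Tk k \<longlongrightarrow> l) (at p within ball c (r k)))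
      \<and> (\<exists>g. ((\<lambda>z. lam (T z) * dn ((p - c) / of_real (r k)) T z) \<longlongrightarrow> g) (at p within Dmatrix N a r)
           \<and> ((\<lambda>z. lamk k (Tk k z) * dn ((p - c) / of_real (r k)) (Tk k) z) \<longlongrightarrow> g) (at p within ball c (r k))))"

definition solves_L ::
  "nat \<Rightarrow> (nat \<Rightarrow> complex) \<Rightarrow> (nat \<Rightarrow> real) \<Rightarrow> (nat \<Rightarrow> real)
   \<Rightarrow> real \<Rightarrow> real \<Rightarrow> (real \<Rightarrow> int \<Rightarrow> int \<Rightarrow> real) \<Rightarrow> (real \<Rightarrow> int \<Rightarrow> int \<Rightarrow> real)
   \<Rightarrow> (real \<Rightarrow> int \<Rightarrow> int \<Rightarrow> real) \<Rightarrow> (real \<Rightarrow> int \<Rightarrow> int \<Rightarrow> real)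
   \<Rightarrow> (complex \<Rightarrow> real) \<Rightarrow> (nat \<Rightarrow> complex \<Rightarrow> real) \<Rightarrow> bool" where
  "solves_L N a r C A \<theta> q1p q1m q2p q2m u uk \<longleftrightarrow>
     (\<forall>z\<in>Dmatrix N a r. laplace_eq u z)
   \<and> (\<forall>k\<in>{1..N}. \<forall>z\<in>Dinc a r k. laplace_eq (uk k) z)
   \<and> cell_bc (px u) (py u) A \<theta> q1p q1m q2p q2m
   \<and> (\<forall>k\<in>{1..N}. \<forall>m1 m2 p. let c = a k + shift m1 m2 in cmod (p - c) = r k \<longrightarrow>
        (\<exists>l. (u \<longlongrightarrow> l) (at p within Dmatrix N a r) \<and> (uk k \<longlongrightarrow> l) (at p within ball c (r k)))
      \<and> (\<exists>g. ((\<lambda>z. dn ((p - c) / of_real (r k)) u z) \<longlongrightarrow> g) (at p within Dmatrix N a r)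
           \<and> ((\<lambda>z. dn ((p - c) / of_real (r k)) (uk k) z / C k) \<longlongrightarrow> g) (at p within ball c (r k))))"

end

theory Submission
  imports Defs
begin

text \<open>With \<open>F\<close> the Kirchhoff transform of \<open>\<lambda>\<close>, the chain rule turns \<open>\<lambda>(T) \<nabla>T\<close> into \<open>\<nabla>(F \<circ> T)\<close>, and
  \<open>C\<^sub>k f\<^sub>k = F\<close> for every \<open>k\<close>, so both phases are transformed by the same function. The equations and
  the cell conditions then correspond pointwise. The delicate step is to recover the interface limit
  of \<open>T\<close> from the limit \<open>l\<close> of \<open>F \<circ> T\<close>, because \<open>F\<close> may be bounded and \<open>l\<close> might be an endpoint of its
  range. Then \<open>l\<close> would be a strict extremum of a harmonic function on each side of the interface. For
  a supremum, the Hopf boundary point lemma makes the normal flux from the inclusion positive, while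
  the difference quotients on the matrix side make it nonpositive. If a second disk touches at the
  same point, the normal ray leaves the matrix, but there the two normals are opposite while both
  fluxes would have to be positive.\<close>

section \<open>Directional derivatives and the Kirchhoff transform\<close>

text \<open>The derivative is real linear, hence determined by its values at 1 and \<i>, which the
  chain rule along the axes identifies with \<open>px\<close> and \<open>py\<close>.\<close>

lemma has_derivative_dn:
  assumes "T differentiable (at z)"
  shows "(T has_derivative (\<lambda>v. dn v T z)) (at z)"
proof -
  obtain D where D: "(T has_derivative D) (at z)"
    using assms by (auto simp: differentiable_def)
  then have lin: "linear D"
    using has_derivative_linear by blast
  have along: "deriv (\<lambda>t::real. T (z + w * of_real t)) 0 = D w" for w
  proof -
    have "((\<lambda>t::real. T (z + w * of_real t)) has_derivative (\<lambda>t. D (w * of_real t))) (at 0)"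
      by (rule has_derivative_compose[where g=T, of "\<lambda>t::real. z + w * of_real t"])
        (use D in \<open>auto intro!: derivative_eq_intros\<close>)
    moreover have "(\<lambda>t. D (w * of_real t)) = (*) (D w)"
      using linear_scale[OF lin, of _ w] by (auto simp: scaleR_conv_of_real mult.commute)
    ultimately show ?thesis
      by (auto intro!: DERIV_imp_deriv simp: has_field_derivative_def)
  qed
  have "D v = dn v T z" for v
  proof -
    have "D v = D (Re v *\<^sub>R 1 + Im v *\<^sub>R \<i>)"
      by (rule arg_cong[where f=D]) (simp add: complex_eq_iff)
    also have "\<dots> = Re v * D 1 + Im v * D \<i>"
      by (simp add: linear_add[OF lin] linear_scale[OF lin])
    finally show ?thesis
      using along[of 1] along[of \<i>] by (simp add: dn_def px_def py_def)
  qed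
  then have "D = (\<lambda>v. dn v T z)" by auto
  with D show ?thesis by simp
qed

lemma dn_eqI:
  assumes "(T has_derivative D) (at z)"
  shows "dn v T z = D v"
proof -
  have "T differentiable (at z)" using assms by (auto simp: differentiable_def)
  from has_derivative_unique[OF assms has_derivative_dn[OF this]] show ?thesis by simp
qed

text \<open>Lets one rule for \<open>dn\<close> serve both partial derivatives.\<close>

lemma px_eq_dn: "px T z = dn 1 T z" and py_eq_dn: "py T z = dn \<i> T z"
  by (simp_all add: dn_def)

lemma DERIV_dn_along:
  assumes "T differentiable (at (z + of_real s * v))"
  shows "((\<lambda>t::real. T (z + of_real t * v)) has_real_derivative dn v T (z + of_real s * v)) (at s)"
proof -
  have "((\<lambda>t::real. T (z + of_real t * v)) has_derivative
      (\<lambda>t. dn (of_real t * v) T (z + of_real s * v))) (at s)"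
    by (rule has_derivative_compose[where g=T, of "\<lambda>t::real. z + of_real t * v"])
      (use has_derivative_dn[OF assms] in \<open>auto intro!: derivative_eq_intros\<close>)
  moreover have "(\<lambda>t. dn (of_real t * v) T (z + of_real s * v)) = (*) (dn v T (z + of_real s * v))"
    by (auto simp: dn_def algebra_simps)
  ultimately show ?thesis
    by (simp add: has_field_derivative_def)
qed

section \<open>Locality of derivatives and of the Laplace equation on open sets\<close>

lemma
  assumes "open S" "z \<in> S" "\<And>w. w \<in> S \<Longrightarrow> f w = g w"
  shows px_cong: "px f z = px g z" and py_cong: "py f z = py g z"
proof -
  have ev: "\<forall>\<^sub>F t in nhds 0. f (z + w * of_real t) = g (z + w * of_real t)" for w
  proof -
    have "open ((\<lambda>t::real. z + w * of_real t) -` S)"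
      by (rule open_vimage[OF assms(1)]) (intro continuous_intros)
    then show ?thesis
      by (rule eventually_mono[OF eventually_nhds_in_open]) (use assms in auto)
  qed
  show "px f z = px g z"
    unfolding px_def using ev[of 1] by (intro deriv_cong_ev) auto
  show "py f z = py g z"
    unfolding py_def using ev[of \<i>] by (intro deriv_cong_ev) auto
qed

lemma dn_cong:
  assumes "open S" "z \<in> S" "\<And>w. w \<in> S \<Longrightarrow> f w = g w"
  shows "dn v f z = dn v g z"
  using px_cong[OF assms] py_cong[OF assms] by (simp add: dn_def)

lemma differentiable_cong_open:
  assumes "open S" "z \<in> S" "\<And>w. w \<in> S \<Longrightarrow> f w = g w"
  shows "f differentiable (at z) \<longleftrightarrow> g differentiable (at z)"
proof -
  have "g differentiable (at z)"
    if "f differentiable (at z)" "\<And>w. w \<in> S \<Longrightarrow> f w = g w" for f g :: "_ \<Rightarrow> 'b"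
    using that assms(1,2) has_derivative_transform_within_open
    unfolding differentiable_def by blast
  from this[of f g] this[of g f] assms(3) show ?thesis by auto
qed

lemma laplace_eq_cong:
  assumes "open S" "z \<in> S" "\<And>w. w \<in> S \<Longrightarrow> u w = v w"
  shows "laplace_eq u z \<longleftrightarrow> laplace_eq v z"
proof -
  have x: "px u w = px v w" and y: "py u w = py v w" if "w \<in> S" for w
    using px_cong[OF assms(1) that assms(3)] py_cong[OF assms(1) that assms(3)] by auto
  have "px (px u) z = px (px v) z" "py (py u) z = py (py v) z"
    using px_cong[OF assms(1,2) x] py_cong[OF assms(1,2) y] by auto
  then show ?thesis
    unfolding laplace_eq_def
    using differentiable_cong_open[OF assms(1,2) assms(3)]
      differentiable_cong_open[OF assms(1,2) x] differentiable_cong_open[OF assms(1,2) y]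
    by simp
qed

lemma dn_chain:
  assumes "(F has_real_derivative d) (at (T z))" "T differentiable (at z)"
  shows "dn v (\<lambda>w. F (T w)) z = d * dn v T z"
  using dn_eqI[OF has_derivative_compose[OF has_derivative_dn[OF assms(2)]
        assms(1)[unfolded has_field_derivative_def]]] by simp

lemma dn_cmult:
  assumes "T differentiable (at z)"
  shows "dn v (\<lambda>w. c * T w) z = c * dn v T z"
  by (rule dn_eqI) (intro has_derivative_mult_right has_derivative_dn assms)

lemma differentiable_cmult_iff:
  fixes f :: "complex \<Rightarrow> real"
  assumes "c \<noteq> 0"
  shows "(\<lambda>w. c * f w) differentiable (at z) \<longleftrightarrow> f differentiable (at z)"
proof
  assume "(\<lambda>w. c * f w) differentiable (at z)"
  then have "(\<lambda>w. inverse c * (c * f w)) differentiable (at z)"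
    by (rule differentiable_mult[rotated]) auto
  moreover have "(\<lambda>w. inverse c * (c * f w)) = f" using assms by auto
  ultimately show "f differentiable (at z)" by (simp only:)
qed (auto intro: differentiable_mult)

section \<open>Strictly increasing changes of the dependent variable\<close>

lemma DERIV_pos_strict_mono:
  fixes F :: "real \<Rightarrow> real"
  assumes "\<And>t. (F has_real_derivative F' t) (at t)" "\<And>t. 0 < F' t"
  shows "strict_mono F"
proof (rule strict_monoI)
  fix x y :: real assume "x < y"
  then show "F x < F y"
    by (rule DERIV_pos_imp_increasing) (meson assms)
qed

text \<open>The range of \<open>F\<close> may be a bounded interval, so regularity of
  \<open>inv F\<close> is claimed only at values \<open>F t\<close>.\<close>

lemma
  fixes F :: "real \<Rightarrow> real"
  assumes F: "\<And>t. (F has_real_derivative F' t) (at t)" and pos: "\<And>t. 0 < F' t"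
  shows isCont_inv_DERIV_pos: "isCont (inv F) (F t)"
    and DERIV_inv_DERIV_pos: "(inv F has_real_derivative inverse (F' t)) (at (F t))"
proof -
  have mono: "strict_mono F" using DERIV_pos_strict_mono[OF assms] .
  then have inj: "inj F" by (simp add: strict_mono_imp_inj_on)
  have cont: "isCont F s" for s using F DERIV_isCont by blast
  show 1: "isCont (inv F) (F t)"
    by (rule isCont_inverse_function[where d=1]) (simp_all add: inj cont)
  show "(inv F has_real_derivative inverse (F' t)) (at (F t))"
  \<comment> \<open>By the intermediate value theorem, everything between \<open>F (t - 1)\<close>
    and \<open>F (t + 1)\<close> lies in the range of \<open>F\<close>, so \<open>inv F\<close> is a
    right inverse near \<open>F t\<close>.\<close>
  proof (rule DERIV_inverse_function[where f=F and a="F (t - 1)" and b="F (t + 1)"])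
    show "(F has_real_derivative F' t) (at (inv F (F t)))"
      using F by (simp add: inv_f_f[OF inj])
    show "F' t \<noteq> 0" using pos[of t] by simp
    show "F (t - 1) < F t" "F t < F (t + 1)" using mono by (simp_all add: strict_mono_less)
    show "isCont (inv F) (F t)" by (rule 1)
    fix y assume y: "F (t - 1) < y" "y < F (t + 1)"
    have "\<exists>x. t - 1 \<le> x \<and> x \<le> t + 1 \<and> F x = y"
      by (rule IVT) (simp_all add: less_imp_le[OF y(1)] less_imp_le[OF y(2)] cont)
    then show "F (inv F y) = y" by (auto simp: inv_f_f[OF inj])
  qed
qed

text \<open>The backward direction writes \<open>T\<close> as \<open>inv F\<close> applied to
  \<open>F (T w)\<close>. It carries differentiability from (L) back to (NL).\<close>

lemma differentiable_compose_DERIV_pos_iff: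
  fixes F :: "real \<Rightarrow> real" and T :: "complex \<Rightarrow> real"
  assumes F: "\<And>t. (F has_real_derivative F' t) (at t)" and pos: "\<And>t. 0 < F' t"
  shows "(\<lambda>w. F (T w)) differentiable (at z) \<longleftrightarrow> T differentiable (at z)"
proof
  assume "T differentiable (at z)"
  moreover have "F differentiable (at (T z))"
    using F real_differentiable_def by blast
  ultimately show "(\<lambda>w. F (T w)) differentiable (at z)"
    using differentiable_chain_at[of T z F] by (simp add: o_def)
next
  assume "(\<lambda>w. F (T w)) differentiable (at z)"
  moreover have "inv F differentiable (at (F (T z)))"
    using DERIV_inv_DERIV_pos[OF assms] real_differentiable_def by blast
  ultimately have "(\<lambda>w. inv F (F (T w))) differentiable (at z)"
    using differentiable_chain_at[of "\<lambda>w. F (T w)" z "inv F"] by (simp add: o_def)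
  moreover have "inj F"
    using DERIV_pos_strict_mono[OF assms] by (simp add: strict_mono_imp_inj_on)
  ultimately show "T differentiable (at z)" by simp
qed

text \<open>The gradient of \<open>F (T w)\<close> is \<open>C * c (T w)\<close> times that of
  \<open>T\<close>, so its Laplacian is \<open>C\<close> times the divergence. The factor
  \<open>C\<close> is 1 in the matrix and C_k in the inclusions, which lets the same
  \<open>F\<close> serve both phases.\<close>

lemma div_eq_iff_laplace_eq:
  fixes F c :: "real \<Rightarrow> real" and T :: "complex \<Rightarrow> real"
  assumes F: "\<And>t. (F has_real_derivative C * c t) (at t)" and c: "\<And>t. 0 < c t" and C: "0 < C"
    and S: "open S"
  shows "(\<forall>z\<in>S. div_eq c T z) \<longleftrightarrow> (\<forall>z\<in>S. laplace_eq (\<lambda>w. F (T w)) z)"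
proof -
  have Cc: "0 < C * c t" for t using c C by simp
  note iff = differentiable_compose_DERIV_pos_iff[OF F Cc]
  \<comment> \<open>Differentiating twice at \<open>z\<close> uses the gradient formula on a
    neighbourhood of \<open>z\<close>, so differentiability of \<open>T\<close> is assumed
    throughout \<open>S\<close>; either equation supplies it.\<close>
  have main: "div_eq c T z \<longleftrightarrow> laplace_eq (\<lambda>w. F (T w)) z"
    if T: "\<And>w. w \<in> S \<Longrightarrow> T differentiable (at w)" and z: "z \<in> S" for z
  proof -
    have x: "px (\<lambda>w. F (T w)) w = C * (c (T w) * px T w)"
      and y: "py (\<lambda>w. F (T w)) w = C * (c (T w) * py T w)" if "w \<in> S" for w
      using dn_chain[where F=F and T=T and z=w, OF F T[OF that]]
      unfolding px_eq_dn py_eq_dn by auto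
    have C0: "C \<noteq> 0" using C by simp
    have dx: "px (\<lambda>w. F (T w)) differentiable (at z) \<longleftrightarrow> (\<lambda>w. c (T w) * px T w) differentiable (at z)"
      using differentiable_cong_open[OF S z x] differentiable_cmult_iff[OF C0] by simp
    have dy: "py (\<lambda>w. F (T w)) differentiable (at z) \<longleftrightarrow> (\<lambda>w. c (T w) * py T w) differentiable (at z)"
      using differentiable_cong_open[OF S z y] differentiable_cmult_iff[OF C0] by simp
    have "px (px (\<lambda>w. F (T w))) z = C * px (\<lambda>w. c (T w) * px T w) z"
      if "(\<lambda>w. c (T w) * px T w) differentiable (at z)"
      using dn_cmult[OF that, of 1 C] by (subst px_cong[OF S z x]) (simp_all add: px_eq_dn)
    moreover have "py (py (\<lambda>w. F (T w))) z = C * py (\<lambda>w. c (T w) * py T w) z"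
      if "(\<lambda>w. c (T w) * py T w) differentiable (at z)"
      using dn_cmult[OF that, of \<i> C] by (subst py_cong[OF S z y]) (simp_all add: py_eq_dn)
    ultimately show ?thesis
      unfolding div_eq_def laplace_eq_def iff dx dy
      using C0 by (auto simp flip: distrib_left)
  qed
  show ?thesis
  proof
    assume "\<forall>z\<in>S. div_eq c T z"
    then show "\<forall>z\<in>S. laplace_eq (\<lambda>w. F (T w)) z"
      using main by (auto simp: div_eq_def)
  next
    assume *: "\<forall>z\<in>S. laplace_eq (\<lambda>w. F (T w)) z"
    then have "T differentiable (at w)" if "w \<in> S" for w
      using that iff by (auto simp: laplace_eq_def)
    with * main show "\<forall>z\<in>S. div_eq c T z" by auto
  qed
qed

section \<open>The Kirchhoff transform as an antiderivative\<close>

lemma kirchhoff_DERIV: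
  assumes "continuous_on UNIV g"
  shows "(kirchhoff g has_real_derivative g t) (at t)"
proof -
  \<comment> \<open>This makes \<open>t\<close> an interior point of \<open>{-b..b}\<close>, and
    \<open>-b\<close> a common base point for both sign branches of
    \<open>kirchhoff\<close>.\<close>
  define b where "b = \<bar>t\<bar> + 1"
  have cont: "continuous_on {x..y} g" for x y using assms continuous_on_subset by blast
  have int: "g integrable_on {x..y}" for x y by (rule integrable_continuous_real[OF cont])
  have "((\<lambda>s. integral {-b..s} g - integral {-b..0} g) has_real_derivative g t) (at t within {-b..b})"
    using DERIV_diff[OF integral_has_real_derivative[OF cont, of t "-b" b] DERIV_const]
    by (simp add: b_def abs_if)
  then have d: "((\<lambda>s. integral {-b..s} g - integral {-b..0} g) has_real_derivative g t) (at t)"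
    by (subst (asm) at_within_interior) (auto simp: b_def)
  have ev: "\<forall>\<^sub>F s in nhds t. integral {-b..s} g - integral {-b..0} g = kirchhoff g s"
  proof (rule eventually_mono[OF eventually_nhds_in_open[of "{-b<..<b}"]])
    fix s assume s: "s \<in> {-b<..<b}"
    have b: "- b \<le> 0" by (simp add: b_def)
    show "integral {-b..s} g - integral {-b..0} g = kirchhoff g s"
    proof (cases "0 \<le> s")
      case True
      then show ?thesis
        using Henstock_Kurzweil_Integration.integral_combine[OF b True int] True
        by (simp add: kirchhoff_def)
    next
      case False
      then show ?thesis
        using Henstock_Kurzweil_Integration.integral_combine[of "-b" s 0, OF _ _ int] s by (simp add: kirchhoff_def)
    qed
  qed (auto simp: b_def)
  show ?thesis
    by (rule iffD1[OF DERIV_cong_ev[OF refl ev refl] d])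
qed

lemma smooth_real_continuous: "smooth_real g \<Longrightarrow> continuous_on UNIV g"
  unfolding smooth_real_def
  by (intro continuous_at_imp_continuous_on ballI field_differentiable_imp_continuous_at)
    (metis funpow_0)

text \<open>Source of the identity C_k f_k = f.\<close>

lemma kirchhoff_cmult: "kirchhoff (\<lambda>t. c * g t) x = c * kirchhoff g x"
  by (simp add: kirchhoff_def)

section \<open>The Hopf boundary point lemma\<close>

text \<open>If 0 were a maximum, then \<open>g' 0 = 0\<close>, and \<open>0 < d\<close> would make
  \<open>g'\<close> positive just to the right of 0, where \<open>g\<close> would therefore
  increase.\<close>

lemma second_DERIV_pos_not_max:
  fixes g g' :: "real \<Rightarrow> real"
  assumes e: "0 < e" and g: "\<And>t. \<bar>t\<bar> < e \<Longrightarrow> (g has_real_derivative g' t) (at t)"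
    and g': "(g' has_real_derivative d) (at 0)" and d: "0 < d"
  shows "\<exists>t. \<bar>t\<bar> < e \<and> g 0 < g t"
proof (rule ccontr)
  assume "\<not> ?thesis"
  then have max: "g t \<le> g 0" if "\<bar>t\<bar> < e" for t
    using that by force
  have "g' 0 = 0"
    by (rule DERIV_local_max[OF g[of 0] e]) (simp_all add: e max)
  moreover obtain b where b: "0 < b" "\<And>h. 0 < h \<Longrightarrow> h < b \<Longrightarrow> g' 0 < g' h"
    using DERIV_pos_inc_right[OF g' d] by auto
  ultimately have pos: "0 < g' h" if "0 < h" "h < b" for h
    using that by auto
  define h where "h = min b e / 2"
  have h: "0 < h" "h < b" "h < e" using b(1) e by (auto simp: h_def min_def)
  have "g 0 < g h"
  proof (rule DERIV_pos_imp_increasing_open[OF h(1)])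
    show "\<exists>y. (g has_real_derivative y) (at x) \<and> 0 < y" if "0 < x" "x < h" for x
      by (intro exI[of _ "g' x"] conjI g pos) (use that h in linarith)+
    show "continuous_on {0..h} g"
      by (intro continuous_at_imp_continuous_on ballI DERIV_isCont[OF g]) (use h in auto)
  qed
  with max[of h] h show False by simp
qed

text \<open>This function is the barrier 1/|w - c|^2 along a line parallel to an axis:
  \<open>X + t\<close> is the moving coordinate of w - c and \<open>B\<close> the square of the
  fixed one.\<close>

lemma
  fixes X B t :: real
  assumes "(X + t)\<^sup>2 + B \<noteq> 0"
  shows DERIV_inverse_quadratic: "((\<lambda>t. 1 / ((X + t)\<^sup>2 + B)) has_real_derivative
      - (2 * (X + t) / ((X + t)\<^sup>2 + B)\<^sup>2)) (at t)"
    and DERIV2_inverse_quadratic: "((\<lambda>t. - (2 * (X + t) / ((X + t)\<^sup>2 + B)\<^sup>2)) has_real_derivative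
      8 * (X + t)\<^sup>2 / ((X + t)\<^sup>2 + B) ^ 3 - 2 / ((X + t)\<^sup>2 + B)\<^sup>2) (at t)"
proof -
  let ?q = "\<lambda>t. (X + t)\<^sup>2 + B"
  have q: "(?q has_real_derivative 2 * (X + t)) (at t)"
    by (rule derivative_eq_intros refl | simp)+
  have alg1: "(0 * D - 1 * x) / (D * D) = - (x / D\<^sup>2)" for x D :: real
    by (simp add: power2_eq_square)
  show "((\<lambda>t. 1 / ?q t) has_real_derivative - (2 * (X + t) / (?q t)\<^sup>2)) (at t)"
    by (rule DERIV_cong[OF DERIV_divide[OF DERIV_const q assms] alg1])
  have alg: "- ((2 * D\<^sup>2 - 2 * x * (2 * D * (2 * x))) / (D\<^sup>2 * D\<^sup>2)) = 8 * x\<^sup>2 / D ^ 3 - 2 / D\<^sup>2"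
    if "D \<noteq> 0" for x D :: real
    using that by (simp add: field_simps eval_nat_numeral)
  have lin: "((\<lambda>t. 2 * (X + t)) has_real_derivative 2) (at t)"
    by (rule derivative_eq_intros refl | simp)+
  have sq: "((\<lambda>t. (?q t)\<^sup>2) has_real_derivative 2 * ?q t * (2 * (X + t))) (at t)"
    by (rule DERIV_cong[OF DERIV_power[OF q]]) simp
  show "((\<lambda>t. - (2 * (X + t) / (?q t)\<^sup>2)) has_real_derivative
      8 * (X + t)\<^sup>2 / ?q t ^ 3 - 2 / (?q t)\<^sup>2) (at t)"
    using DERIV_minus[OF DERIV_divide[OF lin sq]] assms alg[OF assms, of "X + t"]
    by simp
qed

text \<open>The interface conditions control only limits at \<open>p\<close>, not a derivative
  there. L'Hopital's rule along the ray turns the limit of the directional derivative into that of a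
  difference quotient, with the limit \<open>M\<close> in place of \<open>u p\<close>.\<close>

lemma directional_quotient_tendsto:
  assumes S: "\<forall>\<^sub>F t in at_right 0. p + of_real t * v \<in> S" and v: "v \<noteq> 0"
    and diff: "\<And>z. z \<in> S \<Longrightarrow> u differentiable (at z)"
    and lim: "(u \<longlongrightarrow> M) (at p within S)" and dlim: "(dn v u \<longlongrightarrow> g) (at p within S)"
  shows "((\<lambda>t. (u (p + of_real t * v) - M) / t) \<longlongrightarrow> g) (at_right 0)"
proof (rule lhopital_right_0[where f'="\<lambda>t. dn v u (p + of_real t * v)" and g'="\<lambda>_. 1"])
  have "((\<lambda>t. p + of_real t * v) \<longlongrightarrow> p + of_real 0 * v) (at_right 0)"
    by (intro tendsto_intros)
  then have F: "filterlim (\<lambda>t. p + of_real t * v) (at p within S) (at_right 0)"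
    unfolding filterlim_at using S v
    by (auto simp: eventually_at_filter elim!: eventually_mono)
  show "((\<lambda>t. u (p + of_real t * v) - M) \<longlongrightarrow> 0) (at_right 0)"
    using filterlim_compose[OF lim F] by (simp add: LIM_zero)
  show "((\<lambda>t. dn v u (p + of_real t * v) / 1) \<longlongrightarrow> g) (at_right 0)"
    using filterlim_compose[OF dlim F] by simp
  show "\<forall>\<^sub>F t in at_right 0. ((\<lambda>t. u (p + of_real t * v) - M) has_real_derivative
      dn v u (p + of_real t * v)) (at t)"
    using S
  proof eventually_elim
    case (elim t)
    show ?case
      using DERIV_diff[OF DERIV_dn_along[OF diff[OF elim]] DERIV_const] by simp
  qed
qed (auto simp: eventually_at_filter)

text \<open>Used with the factor -1, which exchanges infima and suprema.\<close>

lemma laplace_eq_cmult: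
  assumes S: "open S" and lap: "\<And>z. z \<in> S \<Longrightarrow> laplace_eq u z" and z: "z \<in> S"
  shows "laplace_eq (\<lambda>z. c * u z) z"
proof -
  have x: "px (\<lambda>z. c * u z) w = c * px u w" and y: "py (\<lambda>z. c * u z) w = c * py u w"
    if "w \<in> S" for w
    using dn_cmult[of u w] lap[OF that] unfolding px_eq_dn py_eq_dn laplace_eq_def by auto
  have "px (px (\<lambda>z. c * u z)) z = c * px (px u) z" "py (py (\<lambda>z. c * u z)) z = c * py (py u) z"
    using px_cong[OF S z x] py_cong[OF S z y] dn_cmult[of "px u" z 1 c] dn_cmult[of "py u" z \<i> c]
      lap[OF z] by (auto simp: px_eq_dn[symmetric] py_eq_dn[symmetric] laplace_eq_def)
  then show ?thesis
    using lap[OF z] differentiable_cong_open[OF S z x] differentiable_cong_open[OF S z y]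
    by (auto simp: laplace_eq_def differentiable_mult simp flip: distrib_left)
qed

text \<open>The barrier \<open>1 / |w - c|\<^sup>2\<close> is strictly subharmonic: its Laplacian is \<open>4 / |w - c|\<^sup>4\<close>.\<close>

lemma laplace_eq_barrier_not_max:
  assumes lap: "\<And>w. w \<in> ball z e \<Longrightarrow> laplace_eq u w" and e: "0 < e"
    and c: "c \<notin> ball z e" and \<delta>: "0 < \<delta>"
  shows "\<exists>w\<in>ball z e. u z + \<delta> / (cmod (z - c))\<^sup>2 < u w + \<delta> / (cmod (w - c))\<^sup>2"
proof -
  define X Y R where "X = Re z - Re c" and "Y = Im z - Im c" and "R = X\<^sup>2 + Y\<^sup>2"
  have nz: "w \<noteq> c" if "w \<in> ball z e" for w using that c by auto
  have diff: "u differentiable (at w)" if "w \<in> ball z e" for w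
    using lap[OF that] by (simp add: laplace_eq_def)
  have z: "z \<in> ball z e" using e by simp
  have lz: "px u differentiable (at z)" "py u differentiable (at z)"
    "px (px u) z + py (py u) z = 0"
    using lap[OF z] by (auto simp: laplace_eq_def)
  have R: "0 < R"
    using nz[OF z] by (auto simp: R_def X_def Y_def sum_power2_gt_zero_iff complex_eq_iff)
  have "8 * X\<^sup>2 / R ^ 3 + 8 * Y\<^sup>2 / R ^ 3 = 8 * R / R ^ 3"
    by (simp add: R_def add_divide_distrib distrib_left)
  then have "(8 * X\<^sup>2 / R ^ 3 - 2 / R\<^sup>2) + (8 * Y\<^sup>2 / R ^ 3 - 2 / R\<^sup>2) = 8 * R / R ^ 3 - 4 / R\<^sup>2"
    by simp
  from arg_cong[OF this, of "\<lambda>x. \<delta> * x"]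
  have "px (px u) z + \<delta> * (8 * X\<^sup>2 / R ^ 3 - 2 / R\<^sup>2) + (py (py u) z + \<delta> * (8 * Y\<^sup>2 / R ^ 3 - 2 / R\<^sup>2))
      = \<delta> * (8 * R / R ^ 3 - 4 / R\<^sup>2)"
    using lz(3) by (simp only: distrib_left)
  also have "\<dots> = \<delta> * 4 / R\<^sup>2" using R by (simp add: eval_nat_numeral divide_simps)
  also have "\<dots> > 0" using R \<delta> by simp
  \<comment> \<open>The two second derivatives of \<open>u\<close> plus the barrier have a positive
    sum, so one of them is positive and the one-variable test applies in that direction.\<close>
  finally consider "0 < px (px u) z + \<delta> * (8 * X\<^sup>2 / R ^ 3 - 2 / R\<^sup>2)"
    | "0 < py (py u) z + \<delta> * (8 * Y\<^sup>2 / R ^ 3 - 2 / R\<^sup>2)" by linarith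
  then show ?thesis
  proof cases
    case 1
    let ?g = "\<lambda>t. u (z + of_real t * 1) + \<delta> * (1 / ((X + t)\<^sup>2 + Y\<^sup>2))"
    let ?g' = "\<lambda>t. px u (z + of_real t * 1) + \<delta> * - (2 * (X + t) / ((X + t)\<^sup>2 + Y\<^sup>2)\<^sup>2)"
    have in_ball: "z + of_real t * 1 \<in> ball z e" if "\<bar>t\<bar> < e" for t
      using that by (simp add: dist_norm)
    have val: "?g t = u (z + of_real t) + \<delta> / (cmod (z + of_real t - c))\<^sup>2" for t
      by (simp add: cmod_power2 X_def Y_def algebra_simps)
    have ne: "(X + t)\<^sup>2 + Y\<^sup>2 \<noteq> 0" if "\<bar>t\<bar> < e" for t
      using nz[OF in_ball[OF that]]
      by (auto simp: X_def Y_def sum_power2_eq_zero_iff complex_eq_iff)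
    have "\<exists>t. \<bar>t\<bar> < e \<and> ?g 0 < ?g t"
    proof (rule second_DERIV_pos_not_max[OF e _ _ 1])
      show "(?g has_real_derivative ?g' t) (at t)" if "\<bar>t\<bar> < e" for t
        unfolding px_eq_dn
        by (intro DERIV_add DERIV_dn_along diff in_ball DERIV_cmult DERIV_inverse_quadratic ne that)
      show "(?g' has_real_derivative px (px u) z + \<delta> * (8 * X\<^sup>2 / R ^ 3 - 2 / R\<^sup>2)) (at 0)"
        using DERIV_add[OF DERIV_dn_along[of "px u" z 0 1]
            DERIV_cmult[OF DERIV2_inverse_quadratic[OF ne[of 0]], of \<delta>]] lz(1) e
        by (simp add: px_eq_dn[symmetric] R_def)
    qed
    then obtain t where "\<bar>t\<bar> < e" "?g 0 < ?g t" by blast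
    then show ?thesis
      using val[of 0] val[of t] in_ball[of t] by (intro bexI[of _ "z + of_real t"]) auto
  next
    case 2
    \<comment> \<open>The imaginary coordinate moves now, so \<open>X\<close> and \<open>Y\<close>
      exchange roles.\<close>
    let ?g = "\<lambda>t. u (z + of_real t * \<i>) + \<delta> * (1 / ((Y + t)\<^sup>2 + X\<^sup>2))"
    let ?g' = "\<lambda>t. py u (z + of_real t * \<i>) + \<delta> * - (2 * (Y + t) / ((Y + t)\<^sup>2 + X\<^sup>2)\<^sup>2)"
    have in_ball: "z + of_real t * \<i> \<in> ball z e" if "\<bar>t\<bar> < e" for t
      using that by (simp add: dist_norm norm_mult)
    have val: "?g t = u (z + of_real t * \<i>) + \<delta> / (cmod (z + of_real t * \<i> - c))\<^sup>2" for t
      by (simp add: cmod_power2 X_def Y_def algebra_simps)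
    have ne: "(Y + t)\<^sup>2 + X\<^sup>2 \<noteq> 0" if "\<bar>t\<bar> < e" for t
      using nz[OF in_ball[OF that]]
      by (auto simp: X_def Y_def sum_power2_eq_zero_iff complex_eq_iff)
    have "\<exists>t. \<bar>t\<bar> < e \<and> ?g 0 < ?g t"
    proof (rule second_DERIV_pos_not_max[OF e _ _ 2])
      show "(?g has_real_derivative ?g' t) (at t)" if "\<bar>t\<bar> < e" for t
        unfolding py_eq_dn
        by (intro DERIV_add DERIV_dn_along diff in_ball DERIV_cmult DERIV_inverse_quadratic ne that)
      show "(?g' has_real_derivative py (py u) z + \<delta> * (8 * Y\<^sup>2 / R ^ 3 - 2 / R\<^sup>2)) (at 0)"
        using DERIV_add[OF DERIV_dn_along[of "py u" z 0 \<i>]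
            DERIV_cmult[OF DERIV2_inverse_quadratic[OF ne[of 0]], of \<delta>]] lz(2) e
        by (simp add: py_eq_dn[symmetric] R_def add.commute)
    qed
    then obtain t where "\<bar>t\<bar> < e" "?g 0 < ?g t" by blast
    then show ?thesis
      using val[of 0] val[of t] in_ball[of t] by (intro bexI[of _ "z + of_real t * \<i>"]) auto
  qed
qed

text \<open>On an annulus touching the circle at \<open>p\<close>, \<open>u\<close> stays below a
  radial comparison function that equals \<open>M\<close> at \<open>p\<close> and decreases inwards
  at a positive rate. This rate bounds \<open>g\<close> from below.\<close>

lemma hopf_boundary_point:
  assumes r: "0 < r" and p: "cmod (p - c) = r"
    and lap: "\<And>z. z \<in> ball c r \<Longrightarrow> laplace_eq u z"
    and less: "\<And>z. z \<in> ball c r \<Longrightarrow> u z < M"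
    and lim: "(u \<longlongrightarrow> M) (at p within ball c r)"
    and dlim: "(dn ((p - c) / of_real r) u \<longlongrightarrow> g) (at p within ball c r)"
  shows "0 < g"
proof -
  \<comment> \<open>The ball around \<open>c'\<close> of radius \<open>s\<close> is internally tangent at \<open>p\<close>, so that its closure meets the
    circle, where \<open>u\<close> is uncontrolled, only at \<open>p\<close>.\<close>
  define c' s n where "c' = (c + p) / 2" and "s = r / 2" and "n = (p - c) / of_real r"
  have s: "0 < s" using r by (simp add: s_def)
  have n: "cmod n = 1" using r p by (simp add: n_def norm_divide)
  have pn: "p - c = of_real r * n" using r by (simp add: n_def)
  have pc': "p - c' = of_real s * n" and c'c: "c' - c = of_real s * n"
    using pn by (auto simp: c'_def s_def field_simps)
  \<comment> \<open>A point of the smaller closed ball outside the large open ball forces equality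
    in the triangle inequality, so \<open>z - c'\<close> and \<open>c' - c\<close> coincide and
    \<open>z = p\<close>.\<close>
  have inner: "z \<in> ball c r" if "cmod (z - c') \<le> s" "z \<noteq> p" for z
  proof (rule ccontr)
    assume "z \<notin> ball c r"
    then have ge: "2 * s \<le> cmod ((z - c') + (c' - c))"
      by (simp add: s_def dist_norm norm_minus_commute)
    have nc: "cmod (c' - c) = s" using c'c n s by (simp add: norm_mult)
    have eq: "cmod ((z - c') + (c' - c)) = cmod (z - c') + cmod (c' - c)" "cmod (z - c') = s"
      using norm_triangle_ineq[of "z - c'" "c' - c"] ge nc that(1) by linarith+
    have "z - c' = c' - c"
      using eq(1)[unfolded norm_triangle_eq] eq(2) nc s by simp
    then have "z = p" by (simp add: c'_def field_simps)
    with that(2) show False by simp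
  qed
  have ps: "cmod (p - c') = s" using pc' n s by (simp add: norm_mult)
  have diff: "u differentiable (at z)" if "z \<in> ball c r" for z
    using lap[OF that] by (simp add: laplace_eq_def)
  have cont: "isCont u z" if "z \<in> ball c r" for z
    using diff[OF that] differentiable_imp_continuous_within by blast
  \<comment> \<open>The inner circle of the annulus is compact inside the open ball, so the maximum
    of \<open>u\<close> on it is strictly below \<open>M\<close>.\<close>
  define S1 where "S1 = sphere c' (s / 2)"
  have S1: "z \<in> ball c r" "z \<noteq> p" if "z \<in> S1" for z
  proof -
    have *: "cmod (z - c') = s / 2" using that by (simp add: S1_def dist_norm norm_minus_commute)
    then show "z \<noteq> p" using ps s by auto
    with * show "z \<in> ball c r" using s by (intro inner) auto
  qed
  have "continuous_on S1 u"
    using cont S1 by (intro continuous_at_imp_continuous_on) auto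
  moreover have "compact S1" "S1 \<noteq> {}" using s by (auto simp: S1_def)
  ultimately obtain z1 where z1: "z1 \<in> S1" "\<And>z. z \<in> S1 \<Longrightarrow> u z \<le> u z1"
    using continuous_attains_sup by metis
  \<comment> \<open>The barrier terms on the inner and outer circles differ by
    \<open>3 * \<delta> / s\<^sup>2\<close>; this choice makes the difference exactly
    \<open>M - u z1\<close>.\<close>
  define \<delta> where "\<delta> = (M - u z1) * s\<^sup>2 / 3"
  have \<delta>: "0 < \<delta>" using less[OF S1(1)[OF z1(1)]] s by (simp add: \<delta>_def)
  define K where "K = cball c' s - ball c' (s / 2)"
  \<comment> \<open>Assigning the limit \<open>M\<close> at \<open>p\<close> makes \<open>u\<close>
    continuous on the closed annulus, so that \<open>v\<close> attains a maximum there.\<close>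
  define w where "w = (\<lambda>z. if z = p then M else u z)"
  define v where "v = (\<lambda>z. w z + \<delta> / (cmod (z - c'))\<^sup>2)"
  have K: "z \<in> K \<longleftrightarrow> cmod (z - c') \<le> s \<and> s / 2 \<le> cmod (z - c')" for z
    by (auto simp: K_def dist_norm norm_minus_commute)
  have c'K: "c' \<notin> K" using s by (simp add: K)
  have wcont: "continuous_on K w"
    unfolding continuous_on_eq_continuous_within
  proof
    fix z assume z: "z \<in> K"
    show "continuous (at z within K) w"
    proof (cases "z = p")
      case True
      have "(w \<longlongrightarrow> M) (at p within ball c r)"
        using lim by (rule Lim_transform_eventually) (auto simp: w_def eventually_at_filter)
      then have "(w \<longlongrightarrow> M) (at p within K - {p})"
        by (rule tendsto_within_subset) (metis DiffE K inner singletonI subsetI)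
      moreover have "at p within K = at p within K - {p}" by (simp add: at_within_def)
      ultimately show ?thesis
        using True by (simp add: continuous_within w_def)
    next
      case False
      with z have "isCont u z" by (intro cont inner) (auto simp: K)
      moreover have "\<forall>\<^sub>F y in nhds z. w y = u y"
        using False by (auto simp: w_def eventually_nhds intro!: exI[of _ "- {p}"])
      ultimately have "isCont w z" by (simp add: isCont_cong)
      then show ?thesis by (rule continuous_at_imp_continuous_at_within)
    qed
  qed
  have vcont: "continuous_on K v"
    unfolding v_def using c'K by (intro continuous_intros wcont) auto
  have "compact K" unfolding K_def by (intro compact_diff) auto
  moreover have "p \<in> K" using ps s by (simp add: K)
  ultimately obtain z0 where z0: "z0 \<in> K" "\<And>z. z \<in> K \<Longrightarrow> v z \<le> v z0"
    using vcont continuous_attains_sup by (metis empty_iff)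
  have wM: "w z \<le> M" if "cmod (z - c') \<le> s" for z
    using less[OF inner[OF that]] by (auto simp: w_def)
  \<comment> \<open>On the outer circle the bound follows from \<open>w z0 \<le> M\<close>, and on
    the inner circle from the choice of \<open>\<delta>\<close>.\<close>
  have "v z0 \<le> M + \<delta> / s\<^sup>2"
  proof -
    consider "cmod (z0 - c') = s" | "cmod (z0 - c') = s / 2"
      | "s / 2 < cmod (z0 - c')" "cmod (z0 - c') < s"
      using z0(1) by (force simp: K)
    then show ?thesis
    proof cases
      case 1
      then show ?thesis using wM[of z0] by (simp add: v_def)
    next
      case 2
      then have "z0 \<in> S1" by (simp add: S1_def dist_norm norm_minus_commute)
      then have "w z0 \<le> u z1" using z1(2) S1(2) by (simp add: w_def)
      moreover have "u z1 + \<delta> / (s / 2)\<^sup>2 = M + \<delta> / s\<^sup>2"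
        using s by (simp add: \<delta>_def power_divide field_simps)
      ultimately show ?thesis unfolding v_def 2 by linarith
    next
      \<comment> \<open>An interior maximum contradicts strict subharmonicity of the
        barrier.\<close>
      case 3
      have "open (ball c' s - cball c' (s / 2))" by auto
      moreover have "z0 \<in> ball c' s - cball c' (s / 2)"
        using 3 by (simp add: dist_norm norm_minus_commute)
      ultimately obtain e where e: "0 < e" "ball z0 e \<subseteq> ball c' s - cball c' (s / 2)"
        using open_contains_ball by blast
      have sub: "cmod (z - c') < s \<and> s / 2 < cmod (z - c')" if "z \<in> ball z0 e" for z
        using e(2) that by (auto simp: dist_norm norm_minus_commute subset_iff)
      have np: "z \<noteq> p" if "z \<in> ball z0 e" for z using sub[OF that] ps by auto
      have "\<exists>z\<in>ball z0 e. u z0 + \<delta> / (cmod (z0 - c'))\<^sup>2 < u z + \<delta> / (cmod (z - c'))\<^sup>2"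
      proof (rule laplace_eq_barrier_not_max[OF _ e(1) _ \<delta>])
        show "laplace_eq u z" if "z \<in> ball z0 e" for z
          using sub[OF that] np[OF that] by (intro lap inner) auto
        show "c' \<notin> ball z0 e" using sub[of c'] s by auto
      qed
      then obtain z where z: "z \<in> ball z0 e" "v z0 < v z"
        using np np[of z0] e(1) by (auto simp: v_def w_def)
      with z0(2)[of z] sub[of z] show ?thesis by (simp add: K)
    qed
  qed
  then have bound: "u z \<le> M + \<delta> / s\<^sup>2 - \<delta> / (cmod (z - c'))\<^sup>2" if "z \<in> K" "z \<noteq> p" for z
    using z0(2)[OF that(1)] that(2) by (simp add: v_def w_def)
  have ray: "cmod (p + of_real t * - n - c') = s - t" "p + of_real t * - n \<noteq> p"
    if "0 < t" "t < s / 2" for t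
  proof -
    have "p + of_real t * - n - c' = of_real (s - t) * n" using pc' by (simp add: algebra_simps)
    then have "cmod (p + of_real t * - n - c') = \<bar>s - t\<bar> * cmod n"
      by (simp only: norm_mult norm_of_real)
    then show 1: "cmod (p + of_real t * - n - c') = s - t" using n that by simp
    show "p + of_real t * - n \<noteq> p"
    proof
      assume "p + of_real t * - n = p"
      from 1[unfolded this ps] that show False by simp
    qed
  qed
  have ev: "\<forall>\<^sub>F t in at_right 0. 0 < t \<and> t < s / 2"
    by (rule eventually_at_rightI[of 0 "s / 2"]) (use s in auto)
  \<comment> \<open>The ray has to enter the ball, so it follows the inward normal and the limit is
    \<open>- g\<close>.\<close>
  have "((\<lambda>t. (u (p + of_real t * - n) - M) / t) \<longlongrightarrow> - g) (at_right 0)"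
  proof (rule directional_quotient_tendsto[OF _ _ diff lim])
    show "\<forall>\<^sub>F t in at_right 0. p + of_real t * - n \<in> ball c r"
      using ev
    proof eventually_elim
      case (elim t)
      then show ?case using ray[of t] by (intro inner) simp_all
    qed
    show "- n \<noteq> 0" using n by auto
    have "dn (- n) u = (\<lambda>z. - dn n u z)" by (simp add: dn_def fun_eq_iff)
    then show "(dn (- n) u \<longlongrightarrow> - g) (at p within ball c r)"
      using tendsto_minus[OF dlim] by (simp add: n_def)
  qed
  moreover have "\<forall>\<^sub>F t in at_right 0. (u (p + of_real t * - n) - M) / t \<le> - (2 * \<delta> / s ^ 3)"
    using ev
  proof eventually_elim
    case (elim t)
    then have t: "0 < t" "t < s / 2" by auto
    have "p + of_real t * - n \<in> K" using ray[OF t] t by (simp add: K)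
    from bound[OF this ray(2)[OF t], unfolded ray(1)[OF t]]
    have "u (p + of_real t * - n) - M \<le> - (\<delta> * (1 / (s - t)\<^sup>2 - 1 / s\<^sup>2))"
      by (simp add: right_diff_distrib)
    also have "1 / (s - t)\<^sup>2 - 1 / s\<^sup>2 = t * (2 * s - t) / (s\<^sup>2 * (s - t)\<^sup>2)"
      using s t by (simp add: divide_simps) (simp add: power2_eq_square algebra_simps)
    finally have 1: "u (p + of_real t * - n) - M \<le> - (\<delta> * (t * (2 * s - t) / (s\<^sup>2 * (s - t)\<^sup>2)))" .
    \<comment> \<open>After expansion this is 2t^2 \<le> 3st. It bounds the growth of the barrier
      along the ray below by a multiple of \<open>t\<close> that does not degenerate as
      \<open>t\<close> tends to 0.\<close>
    have "2 * (s - t)\<^sup>2 \<le> s * (2 * s - t)"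
      using mult_left_mono[of "2 * t" "3 * s" t] t by (simp add: power2_eq_square algebra_simps)
    then have "2 / s * (s\<^sup>2 * (s - t)\<^sup>2) \<le> (2 * s - t) * s\<^sup>2"
      using s mult_right_mono[of "2 * (s - t)\<^sup>2" "s * (2 * s - t)" s]
      by (simp add: power2_eq_square algebra_simps)
    then have "2 / s ^ 3 \<le> (2 * s - t) / (s\<^sup>2 * (s - t)\<^sup>2)"
      using s t by (simp add: pos_le_divide_eq) (simp add: eval_nat_numeral field_simps)
    then have "t * (\<delta> * (2 / s ^ 3)) \<le> t * (\<delta> * ((2 * s - t) / (s\<^sup>2 * (s - t)\<^sup>2)))"
      using t \<delta> by (intro mult_left_mono) auto
    then have "u (p + of_real t * - n) - M \<le> - (2 * \<delta> / s ^ 3) * t"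
      using 1 by (simp add: ac_simps)
    then show ?case using t by (simp add: pos_divide_le_eq)
  qed
  ultimately have "- g \<le> - (2 * \<delta> / s ^ 3)"
    by (rule tendsto_upperbound) simp
  then show ?thesis using \<delta> s by (smt (verit) divide_pos_pos zero_less_power)
qed

section \<open>Geometry of the cells\<close>

lemma Q0_eq_box: "Q0 = box (Complex (-1/2) (-1/2)) (Complex (1/2) (1/2))"
  by (auto simp: Q0_def in_box_complex_iff)

lemma open_Q0: "open Q0"
  by (simp add: Q0_eq_box open_box)

lemma Q0_iff: "z \<in> Q0 \<longleftrightarrow> \<bar>Re z\<bar> < 1/2 \<and> \<bar>Im z\<bar> < 1/2"
  by (auto simp: Q0_def abs_less_iff)

lemma frontier_Q0_iff:
  "z \<in> frontier Q0 \<longleftrightarrow> \<bar>Re z\<bar> \<le> 1/2 \<and> \<bar>Im z\<bar> \<le> 1/2 \<and> (\<bar>Re z\<bar> = 1/2 \<or> \<bar>Im z\<bar> = 1/2)"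
proof -
  have "0 \<in> box (Complex (-1/2) (-1/2)) (Complex (1/2) (1/2))"
    by (simp add: in_box_complex_iff)
  then have "box (Complex (-1/2) (-1/2)) (Complex (1/2) (1/2)) \<noteq> {}" by blast
  then show ?thesis
    by (auto simp: Q0_eq_box frontier_box in_box_complex_iff in_cbox_complex_iff abs_if)
qed

text \<open>Coordinates from a closed and an open interval of length 1 with the same centre differ
  by less than 1, so an integer difference vanishes.\<close>

lemma shift_minus_Q0_eq_0:
  assumes "w \<in> Q0 \<union> frontier Q0" "w + shift m1 m2 - shift n1 n2 \<in> Q0"
  shows "w \<in> Q0" "m1 = n1" "m2 = n2"
proof -
  have w: "\<bar>Re w\<bar> \<le> 1/2" "\<bar>Im w\<bar> \<le> 1/2"
    using assms(1) by (auto simp: frontier_Q0_iff Q0_iff)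
  have "\<bar>Re w + of_int (m1 - n1)\<bar> < 1/2" "\<bar>Im w + of_int (m2 - n2)\<bar> < 1/2"
    using assms(2) by (auto simp: Q0_iff shift_def add_diff_eq)
  moreover from this w have "\<bar>of_int (m1 - n1) :: real\<bar> < 1" "\<bar>of_int (m2 - n2) :: real\<bar> < 1"
    by linarith+
  then have "m1 - n1 = 0" "m2 - n2 = 0" by linarith+
  ultimately show "w \<in> Q0" "m1 = n1" "m2 = n2"
    by (auto simp: Q0_iff)
qed

text \<open>The translates of the closed cell cover the plane, and the closed disks avoid the cell
  sides. Hence the matrix is the complement of all translated closed disks.\<close>

lemma Dmatrix_iff:
  assumes "\<forall>k\<in>{1..N}. cball (a k) (r k) \<subseteq> Q0"
  shows "z \<in> Dmatrix N a r \<longleftrightarrow> (\<forall>m1 m2. \<forall>k\<in>{1..N}. z - shift m1 m2 \<notin> cball (a k) (r k))"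
proof
  assume "z \<in> Dmatrix N a r"
  then obtain n1 n2 w where w: "w \<in> D0 N a r \<union> frontier Q0" "z = w + shift n1 n2"
    by (auto simp: Dmatrix_def)
  have wQ: "w \<in> Q0 \<union> frontier Q0" using w(1) by (auto simp: D0_def)
  show "\<forall>m1 m2. \<forall>k\<in>{1..N}. z - shift m1 m2 \<notin> cball (a k) (r k)"
  proof (intro allI ballI notI)
    fix m1 m2 k assume k: "k \<in> {1..N}" and in_k: "z - shift m1 m2 \<in> cball (a k) (r k)"
    then have "w + shift n1 n2 - shift m1 m2 \<in> Q0"
      using assms w(2) by blast
    note eq = shift_minus_Q0_eq_0[OF wQ this]
    then have "w \<in> D0 N a r"
      using w(1) open_Q0 by (auto simp: frontier_def interior_open)
    with eq in_k k w(2) show False by (auto simp: D0_def)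
  qed
next
  assume *: "\<forall>m1 m2. \<forall>k\<in>{1..N}. z - shift m1 m2 \<notin> cball (a k) (r k)"
  \<comment> \<open>Rounding both coordinates selects a closed cell that contains
    \<open>z\<close>.\<close>
  define m1 m2 w where "m1 = round (Re z)" and "m2 = round (Im z)" and "w = z - shift m1 m2"
  have w: "\<bar>Re w\<bar> \<le> 1/2" "\<bar>Im w\<bar> \<le> 1/2"
    using of_int_round_abs_le[of "Re z"] of_int_round_abs_le[of "Im z"]
    by (auto simp: w_def shift_def m1_def m2_def abs_minus_commute)
  have "w \<in> D0 N a r \<union> frontier Q0"
  proof (cases "w \<in> Q0")
    case True
    then show ?thesis using * by (auto simp: D0_def w_def)
  next
    case False
    then have "w \<in> frontier Q0" using w by (auto simp: frontier_Q0_iff Q0_iff)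
    then show ?thesis by simp
  qed
  moreover have "z = w + shift m1 m2" by (simp add: w_def)
  ultimately show "z \<in> Dmatrix N a r" unfolding Dmatrix_def by blast
qed

text \<open>The complement is the sum of the closed integer lattice and a compact union of disks,
  hence closed. Openness permits differentiation across the cell sides.\<close>

lemma open_Dmatrix:
  assumes "\<forall>k\<in>{1..N}. cball (a k) (r k) \<subseteq> Q0"
  shows "open (Dmatrix N a r)"
proof -
  define L where "L = {z. Re z \<in> \<int> \<and> Im z \<in> \<int>}"
  define K where "K = (\<Union>k\<in>{1..N}. cball (a k) (r k))"
  have "L = Re -` \<int> \<inter> Im -` \<int>" by (auto simp: L_def)
  also have "closed \<dots>"
    by (intro closed_Int closed_vimage[OF closed_Ints] continuous_on_Re continuous_on_Im continuous_on_id)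
  finally have "closed L" .
  moreover have "compact K" by (auto simp: K_def)
  ultimately have "closed (\<Union>x\<in>L. \<Union>y\<in>K. {x + y})"
    by (rule closed_compact_sums)
  also have "(\<Union>x\<in>L. \<Union>y\<in>K. {x + y}) = - Dmatrix N a r"
  proof -
    have L: "x \<in> L \<longleftrightarrow> (\<exists>m1 m2. x = shift m1 m2)" for x
    proof
      assume "x \<in> L"
      then obtain m1 m2 where "Re x = of_int m1" "Im x = of_int m2"
        by (auto simp: L_def Ints_def)
      then have "x = shift m1 m2" by (simp add: complex_eq_iff shift_def)
      then show "\<exists>m1 m2. x = shift m1 m2" by blast
    qed (auto simp: L_def shift_def)
    have "z \<in> (\<Union>x\<in>L. \<Union>y\<in>K. {x + y}) \<longleftrightarrow> (\<exists>m1 m2. z - shift m1 m2 \<in> K)" for z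
    proof
      assume "z \<in> (\<Union>x\<in>L. \<Union>y\<in>K. {x + y})"
      then obtain x y where xy: "x \<in> L" "y \<in> K" "z = x + y" by (elim UN_E singletonE)
      from xy(1)[unfolded L] obtain m1 m2 where "x = shift m1 m2" by blast
      then show "\<exists>m1 m2. z - shift m1 m2 \<in> K" using xy by (intro exI[of _ m1] exI[of _ m2]) simp
    next
      assume "\<exists>m1 m2. z - shift m1 m2 \<in> K"
      then obtain m1 m2 where m: "z - shift m1 m2 \<in> K" by blast
      have sL: "shift m1 m2 \<in> L" unfolding L by blast
      show "z \<in> (\<Union>x\<in>L. \<Union>y\<in>K. {x + y})"
        by (rule UN_I[where a="shift m1 m2"], rule sL, intro UN_I[where a="z - shift m1 m2"] m) simp
    qed
    moreover have "z \<in> - Dmatrix N a r \<longleftrightarrow> (\<exists>m1 m2. z - shift m1 m2 \<in> K)" for z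
      by (simp add: Dmatrix_iff[OF assms] K_def)
    ultimately show ?thesis by (intro set_eqI) (simp only:)
  qed
  finally show ?thesis by (simp add: open_closed)
qed

lemma open_Dinc: "open (Dinc a r k)"
  by (auto simp: Dinc_def)

lemma ball_subset_Dinc: "ball (a k + shift m1 m2) (r k) \<subseteq> Dinc a r k"
  by (auto simp: Dinc_def)

lemma frontier_Q0_in_Dmatrix: "w \<in> frontier Q0 \<Longrightarrow> w + shift m1 m2 \<in> Dmatrix N a r"
  by (auto simp: Dmatrix_def)

text \<open>The side conditions are imposed at points of the matrix itself, so flux identities valid
  on \<open>Dmatrix\<close> transfer to them directly.\<close>

lemma cell_sides_in_Dmatrix:
  assumes "-1/2 < x" "x < 1/2"
  shows "of_real (x + of_int m1) + \<i> * of_real (of_int m2 + 1/2) \<in> Dmatrix N a r"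
    and "of_real (x + of_int m1) + \<i> * of_real (of_int m2 - 1/2) \<in> Dmatrix N a r"
    and "of_real (of_int m1 + 1/2) + \<i> * of_real (x + of_int m2) \<in> Dmatrix N a r"
    and "of_real (of_int m1 - 1/2) + \<i> * of_real (x + of_int m2) \<in> Dmatrix N a r"
proof -
  have *: "Complex x y + shift m1 m2 \<in> Dmatrix N a r" "Complex y x + shift m1 m2 \<in> Dmatrix N a r"
    if "\<bar>y\<bar> = 1/2" for y
    by (intro frontier_Q0_in_Dmatrix; use that assms in \<open>simp add: frontier_Q0_iff abs_if\<close>)+
  have eq: "of_real (x + of_int m1) + \<i> * of_real (of_int m2 + 1/2) = Complex x (1/2) + shift m1 m2"
    "of_real (x + of_int m1) + \<i> * of_real (of_int m2 - 1/2) = Complex x (-1/2) + shift m1 m2"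
    "of_real (of_int m1 + 1/2) + \<i> * of_real (x + of_int m2) = Complex (1/2) x + shift m1 m2"
    "of_real (of_int m1 - 1/2) + \<i> * of_real (x + of_int m2) = Complex (-1/2) x + shift m1 m2"
    by (auto simp: complex_eq_iff shift_def)
  show "of_real (x + of_int m1) + \<i> * of_real (of_int m2 + 1/2) \<in> Dmatrix N a r"
    "of_real (x + of_int m1) + \<i> * of_real (of_int m2 - 1/2) \<in> Dmatrix N a r"
    "of_real (of_int m1 + 1/2) + \<i> * of_real (x + of_int m2) \<in> Dmatrix N a r"
    "of_real (of_int m1 - 1/2) + \<i> * of_real (x + of_int m2) \<in> Dmatrix N a r"
    unfolding eq by (intro *; simp)+
qed

text \<open>Disjointness keeps the centres at least \<open>r1 + r2\<close> apart, so a common point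
  of the closed disks gives equality in the triangle inequality and lies on the segment between the
  centres.\<close>

lemma tangent_disks_opposite_normals:
  fixes c1 c2 w :: complex
  assumes r: "0 < r1" "0 < r2" and disj: "ball c1 r1 \<inter> ball c2 r2 = {}"
    and w: "cmod (w - c1) = r1" "cmod (w - c2) \<le> r2"
  shows "cmod (w - c2) = r2" "(w - c2) / of_real r2 = - ((w - c1) / of_real r1)"
proof -
  define d where "d = cmod (c2 - c1)"
  have ge: "r1 + r2 \<le> d"
  proof (rule ccontr)
    assume "\<not> r1 + r2 \<le> d"
    then have d: "d / (r1 + r2) < 1" using r by simp
    \<comment> \<open>This point divides the segment of centres in the ratio \<open>r1\<close> to
      \<open>r2\<close>; it lies in both balls if the centres are too close.\<close>
    define x where "x = c1 + of_real (r1 / (r1 + r2)) * (c2 - c1)"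
    have "x - c1 = of_real (r1 / (r1 + r2)) * (c2 - c1)" by (simp add: x_def)
    then have "cmod (x - c1) = r1 / (r1 + r2) * d"
      using r by (simp add: norm_mult d_def norm_divide flip: of_real_add)
    then have "cmod (x - c1) = r1 * (d / (r1 + r2))" by simp
    also have "\<dots> < r1" using d r by (metis mult.right_neutral mult_strict_left_mono)
    finally have 1: "x \<in> ball c1 r1" by (simp add: dist_norm norm_minus_commute)
    have sum: "r1 / (r1 + r2) + r2 / (r1 + r2) = 1" using r by (simp add: add_divide_distrib[symmetric])
    have "c2 - x = of_real (1 - r1 / (r1 + r2)) * (c2 - c1)"
      by (simp add: x_def algebra_simps)
    also have "1 - r1 / (r1 + r2) = r2 / (r1 + r2)" using sum by simp
    finally have "cmod (c2 - x) = r2 / (r1 + r2) * d"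
      using r by (simp add: norm_mult d_def norm_divide flip: of_real_add)
    then have "cmod (c2 - x) = r2 * (d / (r1 + r2))" by simp
    also have "\<dots> < r2" using d r by (metis mult.right_neutral mult_strict_left_mono)
    finally have "x \<in> ball c2 r2" by (simp add: dist_norm)
    with 1 disj show False by blast
  qed
  have "d \<le> cmod (w - c1) + cmod (w - c2)"
    using norm_triangle_ineq[of "w - c1" "c2 - w"] by (simp add: d_def norm_minus_commute)
  with ge w show w2: "cmod (w - c2) = r2" by linarith
  have "cmod ((w - c1) + (c2 - w)) = cmod (w - c1) + cmod (c2 - w)"
    using norm_triangle_ineq[of "w - c1" "c2 - w"] ge w w2
    by (simp add: d_def norm_minus_commute)
  from this[unfolded norm_triangle_eq] have "of_real r1 * (c2 - w) = of_real r2 * (w - c1)"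
    using w w2 by (simp add: norm_minus_commute[of c2] scaleR_conv_of_real)
  then show "(w - c2) / of_real r2 = - ((w - c1) / of_real r1)"
    using r by (simp add: divide_simps) (simp add: algebra_simps)
qed

text \<open>Near \<open>w\<close> the ray stays in the open cell and away from the finitely many
  closed disks that do not contain \<open>w\<close>, so only the disks containing \<open>w\<close>
  have to be checked.\<close>

lemma eventually_ray_in_Dmatrix:
  assumes w: "w \<in> Q0"
    and out: "\<And>i. i \<in> {1..N} \<Longrightarrow> w \<in> cball (a i) (r i) \<Longrightarrow>
      \<forall>\<^sub>F t in at_right 0. w + of_real t * v \<notin> cball (a i) (r i)"
  shows "\<forall>\<^sub>F t in at_right 0. w + shift m1 m2 + of_real t * v \<in> Dmatrix N a r"
proof -
  have "((\<lambda>t. w + of_real t * v) \<longlongrightarrow> w + of_real 0 * v) (at_right 0)"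
    by (intro tendsto_intros)
  then have ev: "\<forall>\<^sub>F t in at_right 0. w + of_real t * v \<in> S" if "open S" "w \<in> S" for S
    using that by (auto simp: tendsto_def)
  have "\<forall>\<^sub>F t in at_right 0. w + of_real t * v \<notin> cball (a i) (r i)" if "i \<in> {1..N}" for i
    using out[OF that] ev[of "- cball (a i) (r i)"] by (cases "w \<in> cball (a i) (r i)") auto
  then have "\<forall>\<^sub>F t in at_right 0. \<forall>i\<in>{1..N}. w + of_real t * v \<notin> cball (a i) (r i)"
    by (intro eventually_ball_finite) auto
  with ev[OF open_Q0 w] show ?thesis
  proof eventually_elim
    case (elim t)
    then have "w + of_real t * v \<in> D0 N a r" by (auto simp: D0_def)
    then have "(w + of_real t * v) + shift m1 m2 \<in> Dmatrix N a r" by (auto simp: Dmatrix_def)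
    then show ?case by (simp add: algebra_simps)
  qed
qed

text \<open>The distance to the centre becomes r + t along the normal and sqrt(r^2 + t^2) along the
  tangent. The sign \<open>s\<close> lets one tangent ray be described from either of two opposite
  normals.\<close>

lemma
  fixes c w :: complex
  assumes r: "0 < r" and w: "cmod (w - c) = r"
  shows normal_ray_outside: "0 < t \<Longrightarrow> w + of_real t * ((w - c) / of_real r) \<notin> cball c r"
    and tangent_ray_outside: "0 < t \<Longrightarrow> \<bar>s\<bar> = 1 \<Longrightarrow>
      w + of_real t * (of_real s * \<i> * ((w - c) / of_real r)) \<notin> cball c r"
proof -
  define n where "n = (w - c) / of_real r"
  have n: "w - c = of_real r * n" "cmod n = 1"
    using r w by (auto simp: n_def norm_divide)
  {
    assume t: "0 < t"
    have "w + of_real t * n - c = of_real (r + t) * n" using n(1) by (simp add: algebra_simps)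
    then have "cmod (w + of_real t * n - c) = r + t" using n r t by (simp add: norm_mult del: of_real_add)
    then show "w + of_real t * ((w - c) / of_real r) \<notin> cball c r"
      using t by (simp add: n_def dist_norm norm_minus_commute)
  }
  assume t: "0 < t" and s: "\<bar>s\<bar> = 1"
  have "w + of_real t * (of_real s * \<i> * n) - c = Complex r (t * s) * n"
    using n(1) by (simp add: algebra_simps Complex_eq)
  then have "cmod (w + of_real t * (of_real s * \<i> * n) - c) = sqrt (r\<^sup>2 + t\<^sup>2)"
    using n(2) s by (simp add: norm_mult complex_norm power_mult_distrib flip: power2_abs[of s])
  also have "\<dots> > r" using r t by (simp add: real_less_rsqrt)
  finally show "w + of_real t * (of_real s * \<i> * ((w - c) / of_real r)) \<notin> cball c r"
    by (simp add: n_def dist_norm norm_minus_commute)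
qed

section \<open>Transmission conditions\<close>

text \<open>The interface clause of \<open>solves_L\<close>, isolated so that it can be transformed
  separately.\<close>

definition transmission ::
  "nat \<Rightarrow> (nat \<Rightarrow> complex) \<Rightarrow> (nat \<Rightarrow> real) \<Rightarrow> (nat \<Rightarrow> real)
   \<Rightarrow> (complex \<Rightarrow> real) \<Rightarrow> (nat \<Rightarrow> complex \<Rightarrow> real) \<Rightarrow> bool" where
  "transmission N a r C u uk \<longleftrightarrow> (\<forall>k\<in>{1..N}. \<forall>m1 m2 p. cmod (p - (a k + shift m1 m2)) = r k \<longrightarrow>
        (\<exists>l. (u \<longlongrightarrow> l) (at p within Dmatrix N a r) \<and> (uk k \<longlongrightarrow> l) (at p within ball (a k + shift m1 m2) (r k)))
      \<and> (\<exists>g. (dn ((p - (a k + shift m1 m2)) / of_real (r k)) u \<longlongrightarrow> g) (at p within Dmatrix N a r)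
           \<and> ((\<lambda>z. dn ((p - (a k + shift m1 m2)) / of_real (r k)) (uk k) z / C k) \<longlongrightarrow> g)
                (at p within ball (a k + shift m1 m2) (r k))))"

lemma transmissionE:
  fixes p :: complex
  assumes "transmission N a r C u uk" "k \<in> {1..N}" "cmod (p - (a k + shift m1 m2)) = r k"
  obtains l g where "(u \<longlongrightarrow> l) (at p within Dmatrix N a r)"
    "(uk k \<longlongrightarrow> l) (at p within ball (a k + shift m1 m2) (r k))"
    "(dn ((p - (a k + shift m1 m2)) / of_real (r k)) u \<longlongrightarrow> g) (at p within Dmatrix N a r)"
    "((\<lambda>z. dn ((p - (a k + shift m1 m2)) / of_real (r k)) (uk k) z / C k) \<longlongrightarrow> g)
      (at p within ball (a k + shift m1 m2) (r k))"
  using assms unfolding transmission_def by blast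

lemma solves_L_iff:
  "solves_L N a r C A \<theta> q1p q1m q2p q2m u uk \<longleftrightarrow>
     (\<forall>z\<in>Dmatrix N a r. laplace_eq u z) \<and> (\<forall>k\<in>{1..N}. \<forall>z\<in>Dinc a r k. laplace_eq (uk k) z)
   \<and> cell_bc (px u) (py u) A \<theta> q1p q1m q2p q2m \<and> transmission N a r C u uk"
  unfolding solves_L_def transmission_def Let_def by simp

lemma tendsto_cong_within:
  assumes "\<And>z. z \<in> S \<Longrightarrow> f z = g z"
  shows "(f \<longlongrightarrow> l) (at p within S) \<longleftrightarrow> (g \<longlongrightarrow> l) (at p within S)"
  by (rule tendsto_cong) (simp add: eventually_at_filter assms)

lemma transmission_cong:
  assumes M: "open (Dmatrix N a r)"
    and u: "\<And>z. z \<in> Dmatrix N a r \<Longrightarrow> u z = v z"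
    and uk: "\<And>k z. k \<in> {1..N} \<Longrightarrow> z \<in> Dinc a r k \<Longrightarrow> uk k z = vk k z"
  shows "transmission N a r C u uk \<longleftrightarrow> transmission N a r C v vk"
proof -
  \<comment> \<open>The implication is proved for arbitrary fields so that it serves in both
    directions.\<close>
  have "transmission N a r C v vk"
    if tr: "transmission N a r C u uk" and u: "\<And>z. z \<in> Dmatrix N a r \<Longrightarrow> u z = v z"
      and uk: "\<And>k z. k \<in> {1..N} \<Longrightarrow> z \<in> Dinc a r k \<Longrightarrow> uk k z = vk k z" for u v uk vk
    unfolding transmission_def
  proof (intro ballI allI impI)
    fix k m1 m2 p
    assume k: "k \<in> {1..N}" and p: "cmod (p - (a k + shift m1 m2)) = r k"
    let ?B = "ball (a k + shift m1 m2) (r k)" and ?n = "(p - (a k + shift m1 m2)) / of_real (r k)"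
    have B: "uk k z = vk k z" if "z \<in> ?B" for z
      using uk[OF k] that ball_subset_Dinc[of a k m1 m2 r] by blast
    have dB: "dn ?n (uk k) z / C k = dn ?n (vk k) z / C k" if "z \<in> ?B" for z
      using dn_cong[OF open_ball that B] by simp
    have dM: "dn ?n u z = dn ?n v z" if "z \<in> Dmatrix N a r" for z
      using dn_cong[OF M that u] .
    obtain l g where *: "(u \<longlongrightarrow> l) (at p within Dmatrix N a r)" "(uk k \<longlongrightarrow> l) (at p within ?B)"
      "(dn ?n u \<longlongrightarrow> g) (at p within Dmatrix N a r)"
      "((\<lambda>z. dn ?n (uk k) z / C k) \<longlongrightarrow> g) (at p within ?B)"
      by (rule transmissionE[OF tr k p])
    have "(v \<longlongrightarrow> l) (at p within Dmatrix N a r)"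
      by (rule tendsto_cong_within[THEN iffD1, OF _ *(1)]) (rule u)
    moreover have "(vk k \<longlongrightarrow> l) (at p within ?B)"
      by (rule tendsto_cong_within[THEN iffD1, OF _ *(2)]) (rule B)
    moreover have "(dn ?n v \<longlongrightarrow> g) (at p within Dmatrix N a r)"
      by (rule tendsto_cong_within[THEN iffD1, OF _ *(3)]) (rule dM)
    moreover have "((\<lambda>z. dn ?n (vk k) z / C k) \<longlongrightarrow> g) (at p within ?B)"
      by (rule tendsto_cong_within[THEN iffD1, OF _ *(4)]) (rule dB)
    ultimately show "(\<exists>l. (v \<longlongrightarrow> l) (at p within Dmatrix N a r) \<and> (vk k \<longlongrightarrow> l) (at p within ?B)) \<and>
      (\<exists>g. (dn ?n v \<longlongrightarrow> g) (at p within Dmatrix N a r) \<and>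
        ((\<lambda>z. dn ?n (vk k) z / C k) \<longlongrightarrow> g) (at p within ?B))"
      by blast
  qed
  note imp = this
  show ?thesis
  proof
    assume "transmission N a r C u uk"
    then show "transmission N a r C v vk" by (rule imp) (simp_all only: u uk)
  next
    assume "transmission N a r C v vk"
    then show "transmission N a r C u uk" by (rule imp) (simp_all only: u uk)
  qed
qed

lemma cell_bc_cong:
  assumes "\<And>z. z \<in> Dmatrix N a r \<Longrightarrow> Gx z = Hx z" "\<And>z. z \<in> Dmatrix N a r \<Longrightarrow> Gy z = Hy z"
  shows "cell_bc Gx Gy A \<theta> q1p q1m q2p q2m \<longleftrightarrow> cell_bc Hx Hy A \<theta> q1p q1m q2p q2m"
  unfolding cell_bc_def
  by (intro iff_allI imp_cong refl; elim conjE)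
    (simp only: assms(2)[OF cell_sides_in_Dmatrix(1)] assms(2)[OF cell_sides_in_Dmatrix(2)]
      assms(1)[OF cell_sides_in_Dmatrix(3)] assms(1)[OF cell_sides_in_Dmatrix(4)])

text \<open>Problem (L) sees only values in the matrix and the inclusions. This matters for the
  converse, where applying the transform after its inverse restores the fields only there.\<close>

lemma solves_L_cong:
  assumes disks: "\<forall>k\<in>{1..N}. cball (a k) (r k) \<subseteq> Q0"
    and u: "\<And>z. z \<in> Dmatrix N a r \<Longrightarrow> u z = v z"
    and uk: "\<And>k z. k \<in> {1..N} \<Longrightarrow> z \<in> Dinc a r k \<Longrightarrow> uk k z = vk k z"
  shows "solves_L N a r C A \<theta> q1p q1m q2p q2m u uk \<longleftrightarrow> solves_L N a r C A \<theta> q1p q1m q2p q2m v vk"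
proof -
  note M = open_Dmatrix[OF disks]
  have "cell_bc (px u) (py u) A \<theta> q1p q1m q2p q2m \<longleftrightarrow> cell_bc (px v) (py v) A \<theta> q1p q1m q2p q2m"
    by (rule cell_bc_cong[of N a r]) (auto intro: px_cong[OF M] py_cong[OF M] u)
  moreover have "(\<forall>z\<in>Dmatrix N a r. laplace_eq u z) \<longleftrightarrow> (\<forall>z\<in>Dmatrix N a r. laplace_eq v z)"
    by (intro ball_cong refl laplace_eq_cong[OF M] u)
  moreover have "(\<forall>k\<in>{1..N}. \<forall>z\<in>Dinc a r k. laplace_eq (uk k) z) \<longleftrightarrow>
      (\<forall>k\<in>{1..N}. \<forall>z\<in>Dinc a r k. laplace_eq (vk k) z)"
    by (intro ball_cong refl laplace_eq_cong[OF open_Dinc] uk)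
  ultimately show ?thesis
    unfolding solves_L_iff using transmission_cong[OF M u uk] by simp
qed

lemma transmission_cmult:
  assumes tr: "transmission N a r C u uk"
    and du: "\<And>z. z \<in> Dmatrix N a r \<Longrightarrow> u differentiable (at z)"
    and duk: "\<And>k z. k \<in> {1..N} \<Longrightarrow> z \<in> Dinc a r k \<Longrightarrow> uk k differentiable (at z)"
  shows "transmission N a r C (\<lambda>z. c * u z) (\<lambda>k z. c * uk k z)"
  unfolding transmission_def
proof (intro ballI allI impI)
  fix k m1 m2 p
  assume k: "k \<in> {1..N}" and p: "cmod (p - (a k + shift m1 m2)) = r k"
  let ?B = "ball (a k + shift m1 m2) (r k)" and ?n = "(p - (a k + shift m1 m2)) / of_real (r k)"
  have dB: "dn ?n (\<lambda>z. c * uk k z) z / C k = c * (dn ?n (uk k) z / C k)" if "z \<in> ?B" for z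
    using dn_cmult[OF duk[OF k]] that ball_subset_Dinc[of a k m1 m2 r] by auto
  have dM: "dn ?n (\<lambda>z. c * u z) z = c * dn ?n u z" if "z \<in> Dmatrix N a r" for z
    using dn_cmult[OF du[OF that]] .
  obtain l g where "(u \<longlongrightarrow> l) (at p within Dmatrix N a r)" "(uk k \<longlongrightarrow> l) (at p within ?B)"
    "(dn ?n u \<longlongrightarrow> g) (at p within Dmatrix N a r)"
    "((\<lambda>z. dn ?n (uk k) z / C k) \<longlongrightarrow> g) (at p within ?B)"
    by (rule transmissionE[OF tr k p])
  from this[THEN tendsto_mult_left, of c]
  show "(\<exists>l. ((\<lambda>z. c * u z) \<longlongrightarrow> l) (at p within Dmatrix N a r)
        \<and> ((\<lambda>z. c * uk k z) \<longlongrightarrow> l) (at p within ?B)) \<and>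
    (\<exists>g. (dn ?n (\<lambda>z. c * u z) \<longlongrightarrow> g) (at p within Dmatrix N a r) \<and>
      ((\<lambda>z. dn ?n (\<lambda>z. c * uk k z) z / C k) \<longlongrightarrow> g) (at p within ?B))"
    using tendsto_cong_within[where f="dn ?n (\<lambda>z. c * u z)", OF dM]
      tendsto_cong_within[where f="\<lambda>z. dn ?n (\<lambda>z. c * uk k z) z / C k", OF dB]
    by blast
qed

text \<open>The strict bound in the inclusions feeds the Hopf lemma and the strict bound in the
  matrix limits the difference quotients; the two signs of the flux are incompatible.\<close>

lemma transmission_no_strict_sup:
  assumes disks: "\<forall>k\<in>{1..N}. 0 < r k \<and> cball (a k) (r k) \<subseteq> Q0"
    and disj: "\<forall>i\<in>{1..N}. \<forall>j\<in>{1..N}. i \<noteq> j \<longrightarrow> ball (a i) (r i) \<inter> ball (a j) (r j) = {}"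
    and C: "\<forall>k\<in>{1..N}. 0 < C k"
    and lap: "\<forall>z\<in>Dmatrix N a r. laplace_eq u z"
    and lapk: "\<forall>k\<in>{1..N}. \<forall>z\<in>Dinc a r k. laplace_eq (uk k) z"
    and tr: "transmission N a r C u uk"
    and k: "k \<in> {1..N}" and p: "cmod (p - (a k + shift m1 m2)) = r k"
    and lim: "(u \<longlongrightarrow> l) (at p within Dmatrix N a r)"
    and less: "\<And>z. z \<in> Dmatrix N a r \<Longrightarrow> u z < l"
    and lessk: "\<And>i z. i \<in> {1..N} \<Longrightarrow> z \<in> Dinc a r i \<Longrightarrow> uk i z < l"
  shows False
proof -
  define w where "w = p - shift m1 m2"
  define n where "n = (\<lambda>i. (w - a i) / of_real (r i))"
  have r: "0 < r i" if "i \<in> {1..N}" for i using disks that by blast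
  have wk: "cmod (w - a k) = r k" using p by (simp add: w_def algebra_simps)
  have p_eq: "w + shift m1 m2 = p" by (simp add: w_def)
  have n_eq: "(p - (a i + shift m1 m2)) / of_real (r i) = n i" for i
    by (simp add: n_def w_def algebra_simps)
  have "w \<in> cball (a k) (r k)" using wk by (simp add: dist_norm norm_minus_commute)
  then have wQ: "w \<in> Q0" using disks k by blast
  have touch: "cmod (w - a i) = r i" "n i = - n k"
    if "i \<in> {1..N}" "i \<noteq> k" "w \<in> cball (a i) (r i)" for i
    using tangent_disks_opposite_normals[OF r[OF k] r[OF that(1)] _ wk, of "a i"] disj k that
    by (auto simp: n_def dist_norm norm_minus_commute)
  have nk: "cmod (n k) = 1" using wk r[OF k] by (simp add: n_def norm_divide)
  \<comment> \<open>The tangent ray stays outside every disk touching at \<open>p\<close>, so limits from the matrix are unique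
    even at a point where two disks touch.\<close>
  have "\<forall>\<^sub>F t in at_right 0. w + shift m1 m2 + of_real t * (\<i> * n k) \<in> Dmatrix N a r"
  proof (rule eventually_ray_in_Dmatrix[OF wQ])
    fix i assume i: "i \<in> {1..N}" "w \<in> cball (a i) (r i)"
    have "\<exists>s::real. \<bar>s\<bar> = 1 \<and> \<i> * n k = of_real s * \<i> * n i \<and> cmod (w - a i) = r i"
    proof (cases "i = k")
      case True
      then show ?thesis using wk by (intro exI[of _ 1]) simp
    next
      case False
      then show ?thesis using touch[OF i(1) False i(2)] by (intro exI[of _ "-1"]) simp
    qed
    then obtain s :: real where s: "\<bar>s\<bar> = 1" "\<i> * n k = of_real s * \<i> * n i" "cmod (w - a i) = r i"
      by blast
    have "w + of_real t * (\<i> * n k) \<notin> cball (a i) (r i)" if "0 < t" for t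
      unfolding s(2) using tangent_ray_outside[OF r[OF i(1)] s(3) that s(1)] unfolding n_def .
    then show "\<forall>\<^sub>F t in at_right 0. w + of_real t * (\<i> * n k) \<notin> cball (a i) (r i)"
      by (auto simp: eventually_at_filter)
  qed
  then have "filterlim (\<lambda>t::real. p + of_real t * (\<i> * n k)) (at p within Dmatrix N a r) (at_right 0)"
    using nk tendsto_eq_intros(1)
    unfolding p_eq filterlim_at
    by (auto simp: eventually_at_filter elim!: eventually_mono intro!: tendsto_eq_intros)
  then have nontriv: "at p within Dmatrix N a r \<noteq> bot"
    by (auto simp: filterlim_def bot.extremum_unique filtermap_bot_iff)
  \<comment> \<open>Every disk touching at \<open>p\<close> shares the limit \<open>l\<close>, so
    the Hopf lemma applies to it with normal derivative \<open>C i * g\<close>; dividing by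
    \<open>C i\<close> keeps the sign.\<close>
  have flux: "\<exists>g>0. (dn (n i) u \<longlongrightarrow> g) (at p within Dmatrix N a r)"
    if i: "i \<in> {1..N}" and wi: "cmod (w - a i) = r i" for i
  proof -
    have pi: "cmod (p - (a i + shift m1 m2)) = r i" using wi by (simp add: w_def algebra_simps)
    let ?B = "ball (a i + shift m1 m2) (r i)"
    obtain l' g where *: "(u \<longlongrightarrow> l') (at p within Dmatrix N a r)" "(uk i \<longlongrightarrow> l') (at p within ?B)"
      "(dn (n i) u \<longlongrightarrow> g) (at p within Dmatrix N a r)"
      "((\<lambda>z. dn (n i) (uk i) z / C i) \<longlongrightarrow> g) (at p within ?B)"
      using transmissionE[OF tr i pi] unfolding n_eq by blast
    have l: "l' = l" using tendsto_unique[OF nontriv *(1) lim] .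
    have Ci: "0 < C i" using C i by blast
    have "(dn (n i) (uk i) \<longlongrightarrow> C i * g) (at p within ?B)"
      using tendsto_mult_left[OF *(4), of "C i"] Ci by simp
    then have "0 < C i * g"
      using hopf_boundary_point[OF r[OF i] pi, of "uk i" l "C i * g"] *(2) l lapk lessk i
        ball_subset_Dinc[of a i m1 m2 r]
      unfolding n_eq by blast
    with Ci *(3) show ?thesis by (auto simp: zero_less_mult_iff)
  qed
  obtain g where g: "0 < g" "(dn (n k) u \<longlongrightarrow> g) (at p within Dmatrix N a r)"
    using flux[OF k wk] by blast
  show False
  proof (cases "\<exists>i\<in>{1..N}. i \<noteq> k \<and> w \<in> cball (a i) (r i)")
    case True
    then obtain i where i: "i \<in> {1..N}" "i \<noteq> k" "w \<in> cball (a i) (r i)" by blast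
    obtain g' where g': "0 < g'" "(dn (n i) u \<longlongrightarrow> g') (at p within Dmatrix N a r)"
      using flux[OF i(1) touch(1)[OF i]] by blast
    \<comment> \<open>Opposite normals give opposite fluxes, yet both limits are positive.\<close>
    have "dn (n i) u = (\<lambda>z. - dn (n k) u z)"
      unfolding touch(2)[OF i] by (simp add: dn_def fun_eq_iff)
    with g'(2) have "((\<lambda>z. - dn (n k) u z) \<longlongrightarrow> g') (at p within Dmatrix N a r)" by simp
    from tendsto_unique[OF nontriv this tendsto_minus[OF g(2)]] g(1) g'(1) show False by simp
  next
    case False
    have "\<forall>\<^sub>F t in at_right 0. w + shift m1 m2 + of_real t * n k \<in> Dmatrix N a r"
    proof (rule eventually_ray_in_Dmatrix[OF wQ])
      fix i assume "i \<in> {1..N}" "w \<in> cball (a i) (r i)"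
      then have "i = k" using False by blast
      then show "\<forall>\<^sub>F t in at_right 0. w + of_real t * n k \<notin> cball (a i) (r i)"
        using normal_ray_outside[OF r[OF k] wk] by (auto simp: eventually_at_filter n_def)
    qed
    then have ray: "\<forall>\<^sub>F t in at_right 0. p + of_real t * n k \<in> Dmatrix N a r" by (simp add: p_eq)
    have "((\<lambda>t. (u (p + of_real t * n k) - l) / t) \<longlongrightarrow> g) (at_right 0)"
      by (rule directional_quotient_tendsto[OF ray _ _ lim g(2)])
        (use nk lap in \<open>auto simp: laplace_eq_def\<close>)
    \<comment> \<open>Here \<open>u\<close> stays below \<open>l\<close> along the outward normal,
      which contradicts the positive flux.\<close>
    moreover have "\<forall>\<^sub>F t in at_right 0. (u (p + of_real t * n k) - l) / t \<le> 0"
    proof -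
      have "\<forall>\<^sub>F t in at_right (0::real). 0 < t" by (simp add: eventually_at_filter)
      with ray show ?thesis
        by eventually_elim (intro divide_nonpos_pos, simp_all add: less less_imp_le)
    qed
    ultimately have "g \<le> 0" by (rule tendsto_upperbound) simp
    with g(1) show False by simp
  qed
qed

section \<open>Equivalence of the two problems\<close>

text \<open>Since \<open>range F\<close> is an interval, a value outside it bounds \<open>F\<close>
  strictly from one side and would be a forbidden extremum at the interface. This keeps
  \<open>T\<close> from diverging at \<open>p\<close> while \<open>F (T z)\<close>
  converges.\<close>

lemma transmission_limit_in_range:
  fixes F :: "real \<Rightarrow> real"
  assumes disks: "\<forall>k\<in>{1..N}. 0 < r k \<and> cball (a k) (r k) \<subseteq> Q0"
    and disj: "\<forall>i\<in>{1..N}. \<forall>j\<in>{1..N}. i \<noteq> j \<longrightarrow> ball (a i) (r i) \<inter> ball (a j) (r j) = {}"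
    and C: "\<forall>k\<in>{1..N}. 0 < C k"
    and F: "continuous_on UNIV F"
    and lap: "\<forall>z\<in>Dmatrix N a r. laplace_eq (\<lambda>w. F (T w)) z"
    and lapk: "\<forall>k\<in>{1..N}. \<forall>z\<in>Dinc a r k. laplace_eq (\<lambda>w. F (Tk k w)) z"
    and tr: "transmission N a r C (\<lambda>z. F (T z)) (\<lambda>k z. F (Tk k z))"
    and k: "k \<in> {1..N}" and p: "cmod (p - (a k + shift m1 m2)) = r k"
    and lim: "((\<lambda>z. F (T z)) \<longlongrightarrow> l) (at p within Dmatrix N a r)"
  shows "l \<in> range F"
proof (rule ccontr)
  assume l: "l \<notin> range F"
  have "connected (range F)"
    by (rule connected_continuous_image[OF F connected_UNIV])
  then have conn: "l \<in> range F" if "F x \<le> l" "l \<le> F y" for x y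
    using that connected_contains_Icc[of "range F" "F x" "F y"] by auto
  have M: "open (Dmatrix N a r)" using open_Dmatrix disks by blast
  consider "\<And>x. F x < l" | "\<And>x. l < F x"
    using conn l by (metis linorder_not_less nle_le)
  then show False
  proof cases
    case 1
    show False
      by (rule transmission_no_strict_sup[OF disks disj C lap lapk tr k p lim]) (rule 1)+
  next
    case 2
    \<comment> \<open>A strict lower bound becomes a strict upper bound after a change of
      sign.\<close>
    have tr': "transmission N a r C (\<lambda>z. - 1 * F (T z)) (\<lambda>k z. - 1 * F (Tk k z))"
      by (rule transmission_cmult[OF tr]) (use lap lapk in \<open>simp_all add: laplace_eq_def\<close>)
    have lap': "\<forall>z\<in>Dmatrix N a r. laplace_eq (\<lambda>w. - 1 * F (T w)) z"
      using laplace_eq_cmult[OF M] lap by blast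
    have lapk': "\<forall>k\<in>{1..N}. \<forall>z\<in>Dinc a r k. laplace_eq (\<lambda>w. - 1 * F (Tk k w)) z"
      using laplace_eq_cmult[OF open_Dinc] lapk by blast
    have "- 1 * F x < - 1 * l" for x using 2[of x] by simp
    then show False
      by (intro transmission_no_strict_sup[OF disks disj C lap' lapk' tr' k p
            tendsto_mult_left[OF lim]])
  qed
qed

text \<open>Writing the limit as \<open>F l\<close> places it in the range, where
  \<open>inv F\<close> is continuous.\<close>

lemma tendsto_DERIV_pos_iff:
  fixes F :: "real \<Rightarrow> real"
  assumes F: "\<And>t. (F has_real_derivative F' t) (at t)" and pos: "\<And>t. 0 < F' t"
  shows "(T \<longlongrightarrow> l) X \<longleftrightarrow> ((\<lambda>z. F (T z)) \<longlongrightarrow> F l) X"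
proof
  assume "(T \<longlongrightarrow> l) X"
  then show "((\<lambda>z. F (T z)) \<longlongrightarrow> F l) X"
    by (rule isCont_tendsto_compose[OF DERIV_isCont[OF F]])
next
  assume "((\<lambda>z. F (T z)) \<longlongrightarrow> F l) X"
  then have "((\<lambda>z. inv F (F (T z))) \<longlongrightarrow> inv F (F l)) X"
    by (rule isCont_tendsto_compose[OF isCont_inv_DERIV_pos[OF F pos]])
  moreover have "inj F"
    using DERIV_pos_strict_mono[OF F pos] by (simp add: strict_mono_imp_inj_on)
  ultimately show "(T \<longlongrightarrow> l) X" by simp
qed

text \<open>Because C_k f_k = f, both transformed fields are compositions with the same
  \<open>F\<close>, and continuity across the interface is one statement about
  \<open>F\<close>.\<close>

lemma solves_NL_iff_solves_L:
  assumes disks: "\<forall>k\<in>{1..N}. 0 < r k \<and> cball (a k) (r k) \<subseteq> Q0"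
    and disj: "\<forall>i\<in>{1..N}. \<forall>j\<in>{1..N}. i \<noteq> j \<longrightarrow> ball (a i) (r i) \<inter> ball (a j) (r j) = {}"
    and F: "\<And>t. (F has_real_derivative lam t) (at t)"
    and lam_pos: "\<And>t. 0 < lam t" and C: "\<forall>k\<in>{1..N}. 0 < C k"
    and lam_prop: "\<forall>k\<in>{1..N}. \<forall>t. lam t = C k * lamk k t"
  shows "solves_NL N a r lam lamk A \<theta> q1p q1m q2p q2m T Tk \<longleftrightarrow>
    solves_L N a r C A \<theta> q1p q1m q2p q2m (\<lambda>z. F (T z)) (\<lambda>k z. F (Tk k z))"
proof -
  let ?D = "Dmatrix N a r"
  have Q: "\<forall>k\<in>{1..N}. cball (a k) (r k) \<subseteq> Q0" using disks by blast
  note M = open_Dmatrix[OF Q]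
  have Ck: "0 < C k" and lamk: "lam t = C k * lamk k t" and lamk_pos: "0 < lamk k t"
    if "k \<in> {1..N}" for k t
  proof -
    show 1: "0 < C k" "lam t = C k * lamk k t" using C lam_prop that by blast+
    show "0 < lamk k t" using lam_pos[of t] 1 by (simp add: zero_less_mult_iff)
  qed
  have contF: "continuous_on UNIV F"
    by (intro continuous_at_imp_continuous_on ballI DERIV_isCont[OF F])
  note lim_iff = tendsto_DERIV_pos_iff[where F=F, OF F lam_pos]
  have eq1: "(\<forall>z\<in>?D. div_eq lam T z) \<longleftrightarrow> (\<forall>z\<in>?D. laplace_eq (\<lambda>w. F (T w)) z)"
    using div_eq_iff_laplace_eq[where F=F and C=1, OF _ lam_pos _ M] F by simp
  have eq2: "(\<forall>z\<in>Dinc a r k. div_eq (lamk k) (Tk k) z) \<longleftrightarrow>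
      (\<forall>z\<in>Dinc a r k. laplace_eq (\<lambda>w. F (Tk k w)) z)" if "k \<in> {1..N}" for k
    by (rule div_eq_iff_laplace_eq[where C="C k", OF _ lamk_pos[OF that] Ck[OF that] open_Dinc])
      (use F in \<open>simp flip: lamk[OF that]\<close>)
  \<comment> \<open>The chain rule needs differentiable fields, so the side and interface conditions
    are compared only once the differential equations hold.\<close>
  have eq34: "(cell_bc (\<lambda>z. lam (T z) * px T z) (\<lambda>z. lam (T z) * py T z) A \<theta> q1p q1m q2p q2m \<longleftrightarrow>
        cell_bc (px (\<lambda>w. F (T w))) (py (\<lambda>w. F (T w))) A \<theta> q1p q1m q2p q2m) \<and>
      ((\<forall>k\<in>{1..N}. \<forall>m1 m2 p. let c = a k + shift m1 m2 in cmod (p - c) = r k \<longrightarrow>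
        (\<exists>l. (T \<longlongrightarrow> l) (at p within ?D) \<and> (Tk k \<longlongrightarrow> l) (at p within ball c (r k)))
      \<and> (\<exists>g. ((\<lambda>z. lam (T z) * dn ((p - c) / of_real (r k)) T z) \<longlongrightarrow> g) (at p within ?D)
           \<and> ((\<lambda>z. lamk k (Tk k z) * dn ((p - c) / of_real (r k)) (Tk k) z) \<longlongrightarrow> g) (at p within ball c (r k))))
      \<longleftrightarrow> transmission N a r C (\<lambda>z. F (T z)) (\<lambda>k z. F (Tk k z)))" (is "?bc \<and> (?tr \<longleftrightarrow> ?tr')")
    if div: "\<forall>z\<in>?D. div_eq lam T z" "\<forall>k\<in>{1..N}. \<forall>z\<in>Dinc a r k. div_eq (lamk k) (Tk k) z"
  proof
    have dn_M: "lam (T z) * dn v T z = dn v (\<lambda>w. F (T w)) z" if "z \<in> ?D" for v z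
      using dn_chain[where F=F and T=T, OF F] div(1) that by (simp add: div_eq_def)
    \<comment> \<open>The derivative of \<open>F\<close> is \<open>lam\<close>, which is
      \<open>C k\<close> times \<open>lamk k\<close>; this is where the factor 1/C_k in (L) comes
      from.\<close>
    have dn_I: "lamk k (Tk k z) * dn v (Tk k) z = dn v (\<lambda>w. F (Tk k w)) z / C k"
      if "k \<in> {1..N}" "z \<in> Dinc a r k" for v k z
    proof -
      have "dn v (\<lambda>w. F (Tk k w)) z = lam (Tk k z) * dn v (Tk k) z"
        using div(2) that by (intro dn_chain F) (simp add: div_eq_def)
      then show ?thesis using lamk[OF that(1)] Ck[OF that(1)] by simp
    qed
    show ?bc
      by (rule cell_bc_cong[of N a r]) (simp_all add: px_eq_dn py_eq_dn dn_M)
    have flux: "((\<lambda>z. lam (T z) * dn v T z) \<longlongrightarrow> g) (at p within ?D) \<longleftrightarrow>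
        (dn v (\<lambda>w. F (T w)) \<longlongrightarrow> g) (at p within ?D)" for v p g
      by (rule tendsto_cong_within) (rule dn_M)
    have fluxk: "((\<lambda>z. lamk k (Tk k z) * dn v (Tk k) z) \<longlongrightarrow> g)
          (at p within ball (a k + shift m1 m2) (r k)) \<longleftrightarrow>
        ((\<lambda>z. dn v (\<lambda>w. F (Tk k w)) z / C k) \<longlongrightarrow> g)
          (at p within ball (a k + shift m1 m2) (r k))" if "k \<in> {1..N}" for k v p g m1 m2
      by (rule tendsto_cong_within, rule dn_I[OF that]) (use ball_subset_Dinc in blast)
    have lap: "\<forall>z\<in>?D. laplace_eq (\<lambda>w. F (T w)) z"
      "\<forall>k\<in>{1..N}. \<forall>z\<in>Dinc a r k. laplace_eq (\<lambda>w. F (Tk k w)) z"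
      using div eq1 eq2 by auto
    show "?tr \<longleftrightarrow> ?tr'"
    proof
      assume tr: ?tr
      show ?tr'
        unfolding transmission_def
      proof (intro ballI allI impI conjI)
        fix k m1 m2 p
        assume k: "k \<in> {1..N}" and p: "cmod (p - (a k + shift m1 m2)) = r k"
        have *: "\<exists>l. (T \<longlongrightarrow> l) (at p within ?D) \<and> (Tk k \<longlongrightarrow> l) (at p within ball (a k + shift m1 m2) (r k))"
          "\<exists>g. ((\<lambda>z. lam (T z) * dn ((p - (a k + shift m1 m2)) / of_real (r k)) T z) \<longlongrightarrow> g) (at p within ?D)
            \<and> ((\<lambda>z. lamk k (Tk k z) * dn ((p - (a k + shift m1 m2)) / of_real (r k)) (Tk k) z) \<longlongrightarrow> g)
              (at p within ball (a k + shift m1 m2) (r k))"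
          using tr[unfolded Let_def, rule_format, OF k p] by auto
        show "\<exists>g. (dn ((p - (a k + shift m1 m2)) / of_real (r k)) (\<lambda>z. F (T z)) \<longlongrightarrow> g) (at p within ?D) \<and>
          ((\<lambda>z. dn ((p - (a k + shift m1 m2)) / of_real (r k)) (\<lambda>z. F (Tk k z)) z / C k) \<longlongrightarrow> g)
            (at p within ball (a k + shift m1 m2) (r k))"
          using *(2) unfolding flux fluxk[OF k] .
        obtain l where "(T \<longlongrightarrow> l) (at p within ?D)"
          "(Tk k \<longlongrightarrow> l) (at p within ball (a k + shift m1 m2) (r k))"
          using *(1) by blast
        then show "\<exists>l. ((\<lambda>z. F (T z)) \<longlongrightarrow> l) (at p within ?D) \<and>
          ((\<lambda>z. F (Tk k z)) \<longlongrightarrow> l) (at p within ball (a k + shift m1 m2) (r k))"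
          by (intro exI[of _ "F l"] conjI lim_iff[THEN iffD1])
      qed
    next
      assume tr: ?tr'
      show ?tr
        unfolding Let_def
      proof (intro ballI allI impI conjI)
        fix k m1 m2 p
        assume k: "k \<in> {1..N}" and p: "cmod (p - (a k + shift m1 m2)) = r k"
        obtain l g where *: "((\<lambda>z. F (T z)) \<longlongrightarrow> l) (at p within ?D)"
          "((\<lambda>z. F (Tk k z)) \<longlongrightarrow> l) (at p within ball (a k + shift m1 m2) (r k))"
          and g: "(dn ((p - (a k + shift m1 m2)) / of_real (r k)) (\<lambda>z. F (T z)) \<longlongrightarrow> g) (at p within ?D)"
          "((\<lambda>z. dn ((p - (a k + shift m1 m2)) / of_real (r k)) (\<lambda>z. F (Tk k z)) z / C k) \<longlongrightarrow> g)
            (at p within ball (a k + shift m1 m2) (r k))"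
          by (rule transmissionE[OF tr k p])
        show "\<exists>g. ((\<lambda>z. lam (T z) * dn ((p - (a k + shift m1 m2)) / of_real (r k)) T z) \<longlongrightarrow> g) (at p within ?D)
            \<and> ((\<lambda>z. lamk k (Tk k z) * dn ((p - (a k + shift m1 m2)) / of_real (r k)) (Tk k) z) \<longlongrightarrow> g)
              (at p within ball (a k + shift m1 m2) (r k))"
          unfolding flux fluxk[OF k] using g by (intro exI[of _ g] conjI)
        \<comment> \<open>Only this direction has to pull the limit back through \<open>F\<close>,
          so membership in the range is essential.\<close>
        obtain t where t: "l = F t"
          using transmission_limit_in_range[OF disks disj C contF lap tr k p *(1)] by blast
        show "\<exists>l. (T \<longlongrightarrow> l) (at p within ?D) \<and>
          (Tk k \<longlongrightarrow> l) (at p within ball (a k + shift m1 m2) (r k))"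
          using *[unfolded t, THEN lim_iff[THEN iffD2]] by (intro exI[of _ t] conjI)
      qed
    qed
  qed
  have eq2': "(\<forall>k\<in>{1..N}. \<forall>z\<in>Dinc a r k. div_eq (lamk k) (Tk k) z) \<longleftrightarrow>
      (\<forall>k\<in>{1..N}. \<forall>z\<in>Dinc a r k. laplace_eq (\<lambda>w. F (Tk k w)) z)"
    by (rule ball_cong[OF refl eq2])
  show ?thesis
    unfolding solves_NL_def solves_L_iff eq1[symmetric] eq2'[symmetric]
    by (intro conj_cong refl eq34[THEN conjunct1] eq34[THEN conjunct2])
qed

text \<open>A positive smooth conductivity can have a bounded Kirchhoff transform. The converse
  therefore asks for values in the ranges, where \<open>inv\<close> is a genuine inverse.\<close>

theorem theorem1:
  fixes N :: nat and a :: "nat \<Rightarrow> complex" and r :: "nat \<Rightarrow> real"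
    and lam :: "real \<Rightarrow> real" and lamk :: "nat \<Rightarrow> real \<Rightarrow> real" and C :: "nat \<Rightarrow> real"
    and A \<theta> :: real
    and q1p q1m q2p q2m :: "real \<Rightarrow> int \<Rightarrow> int \<Rightarrow> real"
  assumes disks: "\<forall>k\<in>{1..N}. 0 < r k \<and> cball (a k) (r k) \<subseteq> Q0"
    and disjoint: "\<forall>i\<in>{1..N}. \<forall>j\<in>{1..N}. i \<noteq> j \<longrightarrow> ball (a i) (r i) \<inter> ball (a j) (r j) = {}"
    and lam_smooth: "smooth_real lam" and lam_pos: "\<forall>t. 0 < lam t"
    and lamk_smooth: "\<forall>k\<in>{1..N}. smooth_real (lamk k)"
    and lamk_pos: "\<forall>k\<in>{1..N}. \<forall>t. 0 < lamk k t"
    and C_pos: "\<forall>k\<in>{1..N}. 0 < C k"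
    and lam_prop: "\<forall>k\<in>{1..N}. \<forall>t. lam t = C k * lamk k t"
  shows
    "(\<forall>T Tk. solves_NL N a r lam lamk A \<theta> q1p q1m q2p q2m T Tk \<longleftrightarrow>
        solves_L N a r C A \<theta> q1p q1m q2p q2m
          (\<lambda>z. kirchhoff lam (T z)) (\<lambda>k z. C k * kirchhoff (lamk k) (Tk k z)))
   \<and> (\<forall>u uk. solves_L N a r C A \<theta> q1p q1m q2p q2m u uk
        \<and> (\<forall>z\<in>Dmatrix N a r. u z \<in> range (kirchhoff lam))
        \<and> (\<forall>k\<in>{1..N}. \<forall>z\<in>Dinc a r k. uk k z / C k \<in> range (kirchhoff (lamk k)))
      \<longrightarrow> solves_NL N a r lam lamk A \<theta> q1p q1m q2p q2m
          (\<lambda>z. inv (kirchhoff lam) (u z)) (\<lambda>k z. inv (kirchhoff (lamk k)) (uk k z / C k)))"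
proof -
  have Q: "\<forall>k\<in>{1..N}. cball (a k) (r k) \<subseteq> Q0" using disks by blast
  have F: "(kirchhoff lam has_real_derivative lam t) (at t)" for t
    by (rule kirchhoff_DERIV[OF smooth_real_continuous[OF lam_smooth]])
  have Fk: "C k * kirchhoff (lamk k) t = kirchhoff lam t" if "k \<in> {1..N}" for k t
  proof -
    have "lam = (\<lambda>t. C k * lamk k t)" using lam_prop that by blast
    then show ?thesis using kirchhoff_cmult[of "C k" "lamk k" t] by simp
  qed
  have equiv: "solves_NL N a r lam lamk A \<theta> q1p q1m q2p q2m T Tk \<longleftrightarrow>
      solves_L N a r C A \<theta> q1p q1m q2p q2m
        (\<lambda>z. kirchhoff lam (T z)) (\<lambda>k z. C k * kirchhoff (lamk k) (Tk k z))" for T Tk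
  proof -
    have "solves_NL N a r lam lamk A \<theta> q1p q1m q2p q2m T Tk \<longleftrightarrow>
        solves_L N a r C A \<theta> q1p q1m q2p q2m
          (\<lambda>z. kirchhoff lam (T z)) (\<lambda>k z. kirchhoff lam (Tk k z))"
      by (rule solves_NL_iff_solves_L[OF disks disjoint F spec[OF lam_pos] C_pos lam_prop])
    also have "\<dots> \<longleftrightarrow> solves_L N a r C A \<theta> q1p q1m q2p q2m
        (\<lambda>z. kirchhoff lam (T z)) (\<lambda>k z. C k * kirchhoff (lamk k) (Tk k z))"
      by (rule solves_L_cong[OF Q]) (simp_all only: Fk)
    finally show ?thesis .
  qed
  show ?thesis
  proof (intro conjI allI impI)
    show "solves_NL N a r lam lamk A \<theta> q1p q1m q2p q2m T Tk \<longleftrightarrow>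
      solves_L N a r C A \<theta> q1p q1m q2p q2m
        (\<lambda>z. kirchhoff lam (T z)) (\<lambda>k z. C k * kirchhoff (lamk k) (Tk k z))" for T Tk
      by (rule equiv)
  next
    fix u uk
    assume *: "solves_L N a r C A \<theta> q1p q1m q2p q2m u uk
        \<and> (\<forall>z\<in>Dmatrix N a r. u z \<in> range (kirchhoff lam))
        \<and> (\<forall>k\<in>{1..N}. \<forall>z\<in>Dinc a r k. uk k z / C k \<in> range (kirchhoff (lamk k)))"
    \<comment> \<open>Transforming the recovered temperatures gives back the given fields on the
      relevant regions, so the converse is an instance of the equivalence.\<close>
    have "solves_L N a r C A \<theta> q1p q1m q2p q2m
        (\<lambda>z. kirchhoff lam (inv (kirchhoff lam) (u z)))
        (\<lambda>k z. C k * kirchhoff (lamk k) (inv (kirchhoff (lamk k)) (uk k z / C k))) \<longleftrightarrow>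
      solves_L N a r C A \<theta> q1p q1m q2p q2m u uk"
    proof (rule solves_L_cong[OF Q])
      show "kirchhoff lam (inv (kirchhoff lam) (u z)) = u z" if "z \<in> Dmatrix N a r" for z
        using * that by (intro f_inv_into_f) blast
      show "C k * kirchhoff (lamk k) (inv (kirchhoff (lamk k)) (uk k z / C k)) = uk k z"
        if "k \<in> {1..N}" "z \<in> Dinc a r k" for k z
      proof -
        have "kirchhoff (lamk k) (inv (kirchhoff (lamk k)) (uk k z / C k)) = uk k z / C k"
          using * that by (intro f_inv_into_f) blast
        moreover have "0 < C k" using C_pos that(1) by blast
        ultimately show ?thesis by simp
      qed
    qed
    then show "solves_NL N a r lam lamk A \<theta> q1p q1m q2p q2m
          (\<lambda>z. inv (kirchhoff lam) (u z)) (\<lambda>k z. inv (kirchhoff (lamk k)) (uk k z / C k))"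
      unfolding equiv using * by blast
  qed
qed

end
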